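(* Let $\mu$ be a probability measure on $\partial\mathbb{D}$ of the form $d\mu(\theta)=w(\theta)\frac{d\theta}{2\pi}+d\mu_s$, with $d\mu_s$ singular with respect to $d\theta$, whose Verblunsky coefficients $\{\alpha_j\}_{j=0}^\infty$ are real and obey $$(S-1)^2(S+1)\alpha\in\ell^2,\qquad (S-1)^2\alpha\in\ell^4,\qquad \alpha\in\ell^6 .$$ Then the integral $$\int_0^{2\pi}(1-\cos\theta)^2(1+\cos\theta)\log(w(\theta))\,\frac{d\theta}{2\pi}$$ is finite (i.e. $>-\infty$).
   Context: $S$ is the shift operator on sequences: $(S\alpha)_n=\alpha_{n+1}$. The spaces $\ell^p$ are $\ell^p$ of sequences indexed by $n=0,1,2,\dots$. Verblunsky coefficients: for a probability measure $\mu$ on $\partial\mathbb{D}$ with infinite support, let $\Phi_n$ be its monic orthogonal polynomials; the coefficients $\alpha_n\in\mathbb{D}$ ($\mathbb{D}$ the open unit disk), $n\ge0$, are defined by $\Phi_{n+1}(z)=z\Phi_n(z)-\overline{\alpha}_n\Phi_n^*(z)$, $\Phi_0\equiv1$, $\Phi_n^*(z)=z^n\overline{\Phi_n(1/\bar z)}$. *)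

theory Defs
  imports "HOL-Analysis.Analysis" "HOL-Probability.Probability"
    "HOL-Computational_Algebra.Polynomial"
begin

definition circle_borel :: "complex measure" where
  "circle_borel = restrict_space borel (sphere 0 1)"

text \<open>The measure \<open>d\<theta> / 2\<pi>\<close>, in the angle variable and carried over to the unit circle.\<close>

definition angle_measure :: "real measure" where
  "angle_measure = uniform_measure lborel {0..<2 * pi}"

definition arc_measure :: "complex measure" where
  "arc_measure = distr angle_measure circle_borel cis"

definition ac_part :: "(real \<Rightarrow> real) \<Rightarrow> complex measure" where
  "ac_part w = distr (density angle_measure (\<lambda>\<theta>. ennreal (w \<theta>))) circle_borel cis"

definition mutually_singular :: "'a measure \<Rightarrow> 'a measure \<Rightarrow> bool" where
  "mutually_singular M N \<longleftrightarrow> sets M = sets N \<and>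
     (\<exists>A \<in> sets M. emeasure M A = 0 \<and> emeasure N (space N - A) = 0)"

text \<open>The decomposition \<open>d\<mu> = w d\<theta>/2\<pi> + d\<mu>\<^sub>s\<close>. Only the values of \<open>w\<close> on \<open>[0, 2\<pi>)\<close> matter.\<close>

definition lebesgue_decomposition ::
    "complex measure \<Rightarrow> (real \<Rightarrow> real) \<Rightarrow> complex measure \<Rightarrow> bool" where
  "lebesgue_decomposition \<mu> w \<mu>\<^sub>s \<longleftrightarrow>
     w \<in> borel_measurable borel \<and> (\<forall>\<theta>\<in>{0..<2 * pi}. 0 \<le> w \<theta>) \<and>
     mutually_singular \<mu>\<^sub>s arc_measure \<and>
     (\<forall>A\<in>sets circle_borel. emeasure \<mu> A = emeasure (ac_part w) A + emeasure \<mu>\<^sub>s A)"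

definition measure_support :: "'a::topological_space measure \<Rightarrow> 'a set" where
  "measure_support M =
     {x \<in> space M. \<forall>U. open U \<longrightarrow> x \<in> U \<longrightarrow> emeasure M (U \<inter> space M) > 0}"

definition monic_orthogonal_polys :: "complex measure \<Rightarrow> (nat \<Rightarrow> complex poly) \<Rightarrow> bool" where
  "monic_orthogonal_polys \<mu> \<Phi> \<longleftrightarrow>
     (\<forall>n. degree (\<Phi> n) = n \<and> lead_coeff (\<Phi> n) = 1) \<and>
     (\<forall>m n. m \<noteq> n \<longrightarrow> (\<integral>z. cnj (poly (\<Phi> m) z) * poly (\<Phi> n) z \<partial>\<mu>) = 0)"

definition reversed_poly :: "complex poly \<Rightarrow> complex poly" where
  "reversed_poly p = reflect_poly (map_poly cnj p)"

lemma poly_reversed_poly: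
  assumes "degree p = n" "z \<noteq> 0"
  shows "poly (reversed_poly p) z = z ^ n * cnj (poly p (1 / cnj z))"
proof -
  have deg: "degree (map_poly cnj p) = n"
    using assms(1) by (simp add: degree_map_poly)
  have "poly (map_poly cnj p) (cnj x) = cnj (poly p x)" for x
    by (induction p) (auto simp: map_poly_pCons)
  from this[of "1 / cnj z"] show ?thesis
    using assms(2) deg by (simp add: reversed_poly_def poly_reflect_poly_nz inverse_eq_divide)
qed

text \<open>
  For a measure of infinite support the monic orthogonal polynomials exist and are unique, and
  the recursion then determines \<open>\<alpha>\<close>; that \<open>\<alpha> n\<close> lies in the open unit disk is a consequence.
\<close>

definition verblunsky_coefficients :: "complex measure \<Rightarrow> (nat \<Rightarrow> complex) \<Rightarrow> bool" where
  "verblunsky_coefficients \<mu> \<alpha> \<longleftrightarrow>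
     (\<exists>\<Phi>. monic_orthogonal_polys \<mu> \<Phi> \<and>
        (\<forall>n. \<Phi> (Suc n) = [:0, 1:] * \<Phi> n - smult (cnj (\<alpha> n)) (reversed_poly (\<Phi> n))))"

definition shift :: "(nat \<Rightarrow> complex) \<Rightarrow> nat \<Rightarrow> complex" where
  "shift a = (\<lambda>n. a (Suc n))"

definition shift_minus_1 :: "(nat \<Rightarrow> complex) \<Rightarrow> nat \<Rightarrow> complex" where
  "shift_minus_1 a = (\<lambda>n. shift a n - a n)"

definition shift_plus_1 :: "(nat \<Rightarrow> complex) \<Rightarrow> nat \<Rightarrow> complex" where
  "shift_plus_1 a = (\<lambda>n. shift a n + a n)"

definition in_ell :: "real \<Rightarrow> (nat \<Rightarrow> complex) \<Rightarrow> bool" where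
  "in_ell p a \<longleftrightarrow> summable (\<lambda>n. norm (a n) powr p)"

text \<open>The library has \<open>ln 0 = 0\<close>; here \<open>log 0 = -\<infinity>\<close>, so that the integral is \<open>-\<infinity>\<close> as soon as
  \<open>w\<close> vanishes on a set of positive measure.\<close>

definition ext_ln :: "real \<Rightarrow> ereal" where
  "ext_ln x = (if x \<le> 0 then -\<infinity> else ereal (ln x))"

text \<open>If both parts are infinite the value is \<open>\<infinity> - \<infinity> = \<infinity>\<close>. Hence it is finite iff both parts
  are.\<close>

definition ereal_integral :: "'a measure \<Rightarrow> ('a \<Rightarrow> ereal) \<Rightarrow> ereal" where
  "ereal_integral M f =
     enn2ereal (\<integral>\<^sup>+x. e2ennreal (f x) \<partial>M) - enn2ereal (\<integral>\<^sup>+x. e2ennreal (- f x) \<partial>M)"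

lemma ereal_integral_finite_iff:
  "\<bar>ereal_integral M f\<bar> \<noteq> \<infinity> \<longleftrightarrow>
     (\<integral>\<^sup>+x. e2ennreal (f x) \<partial>M) < \<infinity> \<and> (\<integral>\<^sup>+x. e2ennreal (- f x) \<partial>M) < \<infinity>"
  unfolding ereal_integral_def
  by (cases "\<integral>\<^sup>+x. e2ennreal (f x) \<partial>M"; cases "\<integral>\<^sup>+x. e2ennreal (- f x) \<partial>M")
     (auto simp: top_ereal_def)

end

theory Submission
  imports Defs "HOL-Complex_Analysis.Complex_Analysis"
begin

text \<open>
  Let \<open>Q = (1 - cos \<theta>)\<^sup>2 (1 + cos \<theta>)\<close>. The Bernstein--Szego weight
  \<open>w\<^sub>n = (\<Prod>j<n. 1 - \<alpha>\<^sub>j\<^sup>2) / |\<Phi>\<^sub>n\<^sup>*|\<^sup>2\<close> has the same moments as \<open>\<mu>\<close> up to order \<open>n\<close>. As \<open>\<Phi>\<^sub>n\<^sup>*\<close> has no zeros in the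
  closed disk, \<open>\<integral> Q log w\<^sub>n\<close> is read off the Taylor coefficients of \<open>log \<Phi>\<^sub>n\<^sup>*\<close> up to order three,
  and the Szego recursion turns it into a sum of polynomials in consecutive \<open>\<alpha>\<^sub>j\<close>. Modulo
  telescoping, the quadratic part of the summand is \<open>((S - 1)\<^sup>2 (S + 1) \<alpha>)\<^sup>2 / 8\<close>, and the quartic part is
  \<open>((S - 1)\<^sup>2 \<alpha>)\<^sup>4 / 128\<close> plus \<open>(S - 1)\<^sup>2 (S + 1) \<alpha>\<close> times a cubic form; everything else has degree at
  least six. Hence \<open>\<integral> Q log w\<^sub>n\<close> is bounded below.

  For trigonometric polynomials \<open>f > 0\<close> the bound \<open>log (f w\<^sub>n) \<le> f w\<^sub>n\<close> then gives
  \<open>\<integral> Q log f \<le> 2 \<integral> f d\<mu> + C\<close>, which extends to continuous functions by Stone--Weierstrass and to step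
  functions by regularity. Step functions comparable to \<open>1 / w\<close> off the singular part, and equal to \<open>1\<close>
  on it, keep \<open>\<integral> f d\<mu>\<close> bounded and yield the finiteness of \<open>\<integral> Q log (1 / w)\<close>.
\<close>

section \<open>Summation of the Szego increments\<close>

text \<open>The change of \<open>log_moment\<close> in one recursion step with real coefficients:
  \<open>x\<close> is the new coefficient, and \<open>a\<close>, \<open>b\<close>, \<open>c\<close>
  are its predecessors, latest first. The three summands come from the Taylor coefficients of orders
  one, two and three.\<close>

definition szego_increment :: "real \<Rightarrow> real \<Rightarrow> real \<Rightarrow> real \<Rightarrow> real" where
  "szego_increment x a b c = - (x * a) / 4 - (x * (1 - a\<^sup>2) * b - x\<^sup>2 * a\<^sup>2 / 2) / 2
     + (x * (1 - a\<^sup>2) * (1 - b\<^sup>2) * c - x * (1 - a\<^sup>2) * a * b\<^sup>2 - x\<^sup>2 * a * b * (1 - a\<^sup>2)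
        + x ^ 3 * a ^ 3 / 3) / 4"

definition cobound :: "real \<Rightarrow> real \<Rightarrow> real \<Rightarrow> real" where
  "cobound x a b = (144 * x\<^sup>2 + 96 * a\<^sup>2 + 48 * b\<^sup>2 - 96 * (a * b) - 96 * (x * b)
     + 3 * b ^ 4 - 34 * (b ^ 3 * a) + 12 * (b ^ 3 * x) - 72 * (b\<^sup>2 * a\<^sup>2) + 102 * (b\<^sup>2 * a * x)
     - 78 * (b\<^sup>2 * x\<^sup>2) + 114 * (b * a ^ 3) - 150 * (b * a\<^sup>2 * x) + 48 * (b * a * x\<^sup>2)
     + 10 * (b * x ^ 3) - 5 * a ^ 4 + 98 * (a ^ 3 * x) + 96 * (a\<^sup>2 * x\<^sup>2) + 96 * x ^ 4) / 384"

definition cofactor :: "real \<Rightarrow> real \<Rightarrow> real \<Rightarrow> real \<Rightarrow> real" where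
  "cofactor x a b c = (- 5 * (c * c * b) - 77 * (c * b * b) + 82 * (c * b * a) + 5 * (c * b * x)
     - 48 * (c * a * a) + 28 * (b * b * b) - 142 * (b * b * a) + 34 * (b * b * x)
     + 94 * (b * a * a) - 77 * (b * a * x) - 5 * (b * x * x) - 49 * (a * a * a)) / 192"

definition sextic :: "real \<Rightarrow> real \<Rightarrow> real \<Rightarrow> real \<Rightarrow> real" where
  "sextic x a b c = (3 * (x * c * a * a * b * b) + 3 * (x * a * a * a * b * b)
     + 3 * (x * x * a * a * a * b) + x * x * x * a * a * a) / 12"

text \<open>
  With \<open>x, a, b, c\<close> standing for \<open>\<alpha>\<^sub>n\<^sub>+\<^sub>3, \<alpha>\<^sub>n\<^sub>+\<^sub>2, \<alpha>\<^sub>n\<^sub>+\<^sub>1, \<alpha>\<^sub>n\<close>, the coefficients of \<open>cobound\<close> and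
  \<open>cofactor\<close> are a solution of the linear system expressing that the quartic part is a combination of
  \<open>(a - 2b + c)\<^sup>4\<close>, a coboundary and a multiple of \<open>x - a - b + c\<close>. The terms \<open>x\<^sup>2/2 + x\<^sup>4/4\<close> come from
  \<open>- log (1 - x\<^sup>2) / 2\<close>.
\<close>

lemma szego_increment_decomp:
  "szego_increment x a b c + x\<^sup>2 / 2 + x ^ 4 / 4 =
     (x - a - b + c)\<^sup>2 / 8 + (a - 2 * b + c) ^ 4 / 128 + (cobound x a b - cobound a b c)
     + (x - a - b + c) * cofactor x a b c + sextic x a b c"
  unfolding szego_increment_def cobound_def cofactor_def sextic_def
  by (simp add: field_simps power2_eq_square power3_eq_cube power4_eq_xxxx)

lemma abs_mult3_le:
  fixes u v w m :: real
  assumes "\<bar>u\<bar> \<le> m" "\<bar>v\<bar> \<le> m" "\<bar>w\<bar> \<le> m"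
  shows "\<bar>u * v * w\<bar> \<le> m ^ 3"
  using assms unfolding abs_mult power3_eq_cube by (intro mult_mono) auto

lemma cofactor_bound:
  assumes "\<bar>x\<bar> \<le> m" "\<bar>a\<bar> \<le> m" "\<bar>b\<bar> \<le> m" "\<bar>c\<bar> \<le> m"
  shows "\<bar>cofactor x a b c\<bar> \<le> 4 * m ^ 3"
proof -
  \<comment> \<open>The monomials become opaque variables, so that the estimate is linear. The bound
    768 = 4 * 192 exceeds 646, the sum of the absolute values of the coefficients.\<close>
  have lin: "\<bar>- 5 * t1 - 77 * t2 + 82 * t3 + 5 * t4 - 48 * t5 + 28 * t6 - 142 * t7 + 34 * t8
      + 94 * t9 - 77 * t10 - 5 * t11 - 49 * t12\<bar> \<le> 768 * M"
    if "\<bar>t1\<bar> \<le> M" "\<bar>t2\<bar> \<le> M" "\<bar>t3\<bar> \<le> M" "\<bar>t4\<bar> \<le> M" "\<bar>t5\<bar> \<le> M" "\<bar>t6\<bar> \<le> M"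
      "\<bar>t7\<bar> \<le> M" "\<bar>t8\<bar> \<le> M" "\<bar>t9\<bar> \<le> M" "\<bar>t10\<bar> \<le> M" "\<bar>t11\<bar> \<le> M" "\<bar>t12\<bar> \<le> M"
    for t1 t2 t3 t4 t5 t6 t7 t8 t9 t10 t11 t12 M :: real
    by (rule abs_leI) (use that[THEN abs_le_D1] that[THEN abs_le_D2] in linarith)+
  have "\<bar>- 5 * (c * c * b) - 77 * (c * b * b) + 82 * (c * b * a) + 5 * (c * b * x)
     - 48 * (c * a * a) + 28 * (b * b * b) - 142 * (b * b * a) + 34 * (b * b * x)
     + 94 * (b * a * a) - 77 * (b * a * x) - 5 * (b * x * x) - 49 * (a * a * a)\<bar> \<le> 768 * m ^ 3"
    by (rule lin; rule abs_mult3_le; rule assms)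
  note bound = this
  have div: "\<bar>s / 192\<bar> \<le> 4 * M" if "\<bar>s\<bar> \<le> 768 * M" for s M :: real
    using that by simp
  show ?thesis unfolding cofactor_def by (rule div[OF bound])
qed

lemma sextic_bound:
  assumes "\<bar>x\<bar> \<le> m" "\<bar>a\<bar> \<le> m" "\<bar>b\<bar> \<le> m" "\<bar>c\<bar> \<le> m"
  shows "\<bar>sextic x a b c\<bar> \<le> m ^ 6"
proof -
  have mult6: "\<bar>p * q * r * s * t * u\<bar> \<le> m ^ 6"
    if "\<bar>p\<bar> \<le> m" "\<bar>q\<bar> \<le> m" "\<bar>r\<bar> \<le> m" "\<bar>s\<bar> \<le> m" "\<bar>t\<bar> \<le> m" "\<bar>u\<bar> \<le> m" for p q r s t u
  proof -
    have "\<bar>p * q * r\<bar> * \<bar>s * t * u\<bar> \<le> m ^ 3 * m ^ 3"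
      using that by (intro mult_mono abs_mult3_le) auto
    then show ?thesis by (simp add: abs_mult mult_ac flip: power_add)
  qed
  have lin: "\<bar>3 * t1 + 3 * t2 + 3 * t3 + t4\<bar> \<le> 12 * M"
    if "\<bar>t1\<bar> \<le> M" "\<bar>t2\<bar> \<le> M" "\<bar>t3\<bar> \<le> M" "\<bar>t4\<bar> \<le> M" for t1 t2 t3 t4 M :: real
    by (rule abs_leI) (use that[THEN abs_le_D1] that[THEN abs_le_D2] in linarith)+
  have "\<bar>3 * (x * c * a * a * b * b) + 3 * (x * a * a * a * b * b)
     + 3 * (x * x * a * a * a * b) + x * x * x * a * a * a\<bar> \<le> 12 * m ^ 6"
    by (rule lin; rule mult6; rule assms)
  note bound = this
  have div: "\<bar>s / 12\<bar> \<le> M" if "\<bar>s\<bar> \<le> 12 * M" for s M :: real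
    using that by simp
  show ?thesis unfolding sextic_def by (rule div[OF bound])
qed

lemma cobound_bound:
  assumes "\<bar>x\<bar> \<le> 1" "\<bar>a\<bar> \<le> 1" "\<bar>b\<bar> \<le> 1"
  shows "\<bar>cobound x a b\<bar> \<le> 4"
proof -
  \<comment> \<open>The absolute values of the coefficients add up to 1398, which is below 1536 = 4
    * 384.\<close>
  have lin: "\<bar>144 * t1 + 96 * t2 + 48 * t3 - 96 * t4 - 96 * t5 + 3 * t6 - 34 * t7 + 12 * t8 - 72 * t9
     + 102 * t10 - 78 * t11 + 114 * t12 - 150 * t13 + 48 * t14 + 10 * t15 - 5 * t16 + 98 * t17
     + 96 * t18 + 96 * t19\<bar> \<le> 1536"
    if "\<bar>t1\<bar> \<le> 1" "\<bar>t2\<bar> \<le> 1" "\<bar>t3\<bar> \<le> 1" "\<bar>t4\<bar> \<le> 1" "\<bar>t5\<bar> \<le> 1" "\<bar>t6\<bar> \<le> 1" "\<bar>t7\<bar> \<le> 1"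
      "\<bar>t8\<bar> \<le> 1" "\<bar>t9\<bar> \<le> 1" "\<bar>t10\<bar> \<le> 1" "\<bar>t11\<bar> \<le> 1" "\<bar>t12\<bar> \<le> 1" "\<bar>t13\<bar> \<le> 1"
      "\<bar>t14\<bar> \<le> 1" "\<bar>t15\<bar> \<le> 1" "\<bar>t16\<bar> \<le> 1" "\<bar>t17\<bar> \<le> 1" "\<bar>t18\<bar> \<le> 1" "\<bar>t19\<bar> \<le> 1"
    for t1 t2 t3 t4 t5 t6 t7 t8 t9 t10 t11 t12 t13 t14 t15 t16 t17 t18 t19 :: real
    by (rule abs_leI) (use that[THEN abs_le_D1] that[THEN abs_le_D2] in linarith)+
  have mult: "\<bar>u * v\<bar> \<le> 1" if "\<bar>u\<bar> \<le> 1" "\<bar>v\<bar> \<le> 1" for u v :: real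
    using that by (simp add: abs_mult mult_le_one)
  have pow: "\<bar>u ^ k\<bar> \<le> 1" if "\<bar>u\<bar> \<le> 1" for u :: real and k
    using that by (simp add: power_abs power_le_one)
  have bound: "\<bar>144 * x\<^sup>2 + 96 * a\<^sup>2 + 48 * b\<^sup>2 - 96 * (a * b) - 96 * (x * b)
     + 3 * b ^ 4 - 34 * (b ^ 3 * a) + 12 * (b ^ 3 * x) - 72 * (b\<^sup>2 * a\<^sup>2) + 102 * (b\<^sup>2 * a * x)
     - 78 * (b\<^sup>2 * x\<^sup>2) + 114 * (b * a ^ 3) - 150 * (b * a\<^sup>2 * x) + 48 * (b * a * x\<^sup>2)
     + 10 * (b * x ^ 3) - 5 * a ^ 4 + 98 * (a ^ 3 * x) + 96 * (a\<^sup>2 * x\<^sup>2) + 96 * x ^ 4\<bar> \<le> 1536"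
    by (rule lin; (intro mult pow)?; rule assms)
  have div: "\<bar>s / 384\<bar> \<le> 4" if "\<bar>s\<bar> \<le> 1536" for s :: real
    using that by simp
  show ?thesis unfolding cobound_def by (rule div[OF bound])
qed

text \<open>The difference of the two sides vanishes at 0 and is monotone up to 1/2. The first two
  terms of the series are kept exactly because, with y = \<open>x\<^sup>2\<close>, they have to
  cancel \<open>x\<^sup>2 / 2 + x ^ 4 / 4\<close> in \<open>szego_increment_decomp\<close>.\<close>

lemma minus_ln_one_minus_le:
  fixes y :: real
  assumes "0 \<le> y" "y \<le> 1 / 2"
  shows "- ln (1 - y) \<le> y + y\<^sup>2 / 2 + y ^ 3"
proof -
  define f where "f t = t + t\<^sup>2 / 2 + t ^ 3 + ln (1 - t)" for t :: real
  have "f 0 \<le> f y"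
  proof (rule DERIV_nonneg_imp_nondecreasing[OF assms(1)])
    fix t assume t: "0 \<le> t" "t \<le> y"
    have "(f has_real_derivative 1 + t + 3 * t\<^sup>2 - 1 / (1 - t)) (at t)"
      unfolding f_def using t assms
      by (auto intro!: derivative_eq_intros simp: power2_eq_square field_simps)
    moreover have "1 + t + 3 * t\<^sup>2 - 1 / (1 - t) = t\<^sup>2 * (2 - 3 * t) / (1 - t)"
      using t assms by (simp add: field_simps power2_eq_square)
    moreover have "t\<^sup>2 * (2 - 3 * t) / (1 - t) \<ge> 0"
      using t assms by (intro divide_nonneg_pos mult_nonneg_nonneg) auto
    ultimately show "\<exists>d. (f has_real_derivative d) (at t) \<and> 0 \<le> d" by metis
  qed
  then show ?thesis by (simp add: f_def)
qed

text \<open>By \<open>szego_increment_decomp\<close>, each term is at most a telescoping difference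
  of the bounded \<open>cobound\<close> plus a summable sequence: the logarithm loses its terms of
  orders two and four, the product with \<open>cofactor\<close> splits into a square and a sixth
  power, and the rest is of sixth order.\<close>

lemma szego_increment_sum_bounded:
  fixes a :: "nat \<Rightarrow> real"
  assumes a1: "\<And>n. \<bar>a n\<bar> < 1"
    and s2: "summable (\<lambda>n. (a (n + 3) - a (n + 2) - a (n + 1) + a n)\<^sup>2)"
    and s4: "summable (\<lambda>n. (a (n + 2) - 2 * a (n + 1) + a n) ^ 4)"
    and s6: "summable (\<lambda>n. a n ^ 6)"
  obtains C where "\<And>N. (\<Sum>n<N. - ln (1 - (a (n + 3))\<^sup>2) / 2
      + szego_increment (a (n + 3)) (a (n + 2)) (a (n + 1)) (a n)) \<le> C"
proof -
  define E where "E n = a (n + 3) - a (n + 2) - a (n + 1) + a n" for n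
  define \<gamma> where "\<gamma> n = a (n + 2) - 2 * a (n + 1) + a n" for n
  define m where "m n = max (max \<bar>a (n + 3)\<bar> \<bar>a (n + 2)\<bar>) (max \<bar>a (n + 1)\<bar> \<bar>a n\<bar>)" for n
  define r where "r n = max 0 (- ln (1 - (a (n + 3))\<^sup>2) / 2 - (a (n + 3))\<^sup>2 / 2 - a (n + 3) ^ 4 / 4)" for n
  \<comment> \<open>The factor 17 is generous: 16 / 2 from \<open>cofactor\<close> and 1 from
    \<open>sextic\<close> make 9.\<close>
  define u where "u n = E n ^ 2 + \<gamma> n ^ 4 + 17 * m n ^ 6 + r n" for n
  define G where "G n = cobound (a (n + 2)) (a (n + 1)) (a n)" for n
  have s6k: "summable (\<lambda>n. a (n + k) ^ 6)" for k
    using s6 by (subst summable_iff_shift)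
  have pow6: "\<bar>t\<bar> ^ 6 = t ^ 6" for t :: real
    by (rule power_even_abs) simp
  have m6: "summable (\<lambda>n. m n ^ 6)"
  proof (rule summable_comparison_test', rule summable_add[OF summable_add[OF s6k[of 3] s6k[of 2]] summable_add[OF s6k[of 1] s6]])
    fix n
    have "m n \<in> {\<bar>a (n + 3)\<bar>, \<bar>a (n + 2)\<bar>, \<bar>a (n + 1)\<bar>, \<bar>a n\<bar>}"
      unfolding m_def by (auto simp: max_def)
    then have "m n ^ 6 \<in> {a (n + 3) ^ 6, a (n + 2) ^ 6, a (n + 1) ^ 6, a n ^ 6}"
      using pow6 by fastforce
    moreover have "a k ^ 6 \<ge> 0" for k by simp
    ultimately show "norm (m n ^ 6) \<le> a (n + 3) ^ 6 + a (n + 2) ^ 6 + (a (n + 1) ^ 6 + a n ^ 6)"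
      by (auto simp del: zero_le_power_eq_numeral simp: add_nonneg_nonneg)
  qed
  have "(\<lambda>n. a n ^ 6) \<longlonglongrightarrow> 0" using s6 by (rule summable_LIMSEQ_zero)
  \<comment> \<open>The threshold is (1/2)^3: below it, the square of \<open>a n\<close> is at most
    1/2 and the estimate of the logarithm applies. Summability ignores the finitely many other
    indices.\<close>
  then have "\<forall>\<^sub>F n in sequentially. a n ^ 6 < 1 / 8"
    by (rule order_tendstoD) simp
  then have ev: "\<forall>\<^sub>F n in sequentially. a (n + 3) ^ 6 < 1 / 8"
    by (rule eventually_all_ge_at_top[THEN eventually_mono, THEN eventually_sequentially_seg[THEN iffD2, rule_format]]) auto
  have "summable r"
  proof (rule summable_comparison_test_ev)
    show "\<forall>\<^sub>F n in sequentially. norm (r n) \<le> a (n + 3) ^ 6"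
      using ev
    proof eventually_elim
      fix n assume *: "a (n + 3) ^ 6 < 1 / 8"
      define y where "y = (a (n + 3))\<^sup>2"
      have y3: "a (n + 3) ^ 6 = y ^ 3" "a (n + 3) ^ 4 = y\<^sup>2" by (simp_all add: y_def flip: power_mult)
      have "y \<ge> 0" by (simp add: y_def)
      moreover have "y \<le> 1 / 2"
      proof (rule ccontr)
        assume "\<not> ?thesis"
        then have "(1 / 2) ^ 3 \<le> y ^ 3" by (intro power_mono) auto
        with * y3 show False by (simp add: power3_eq_cube)
      qed
      ultimately have "- ln (1 - y) \<le> y + y\<^sup>2 / 2 + y ^ 3" by (rule minus_ln_one_minus_le)
      moreover have "y ^ 3 \<ge> 0" using \<open>y \<ge> 0\<close> by simp
      ultimately show "norm (r n) \<le> a (n + 3) ^ 6"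
        unfolding r_def y3 by (auto simp: max_def y_def[symmetric])
    qed
  qed (rule s6k)
  then have su: "summable u"
    unfolding u_def E_def \<gamma>_def by (intro summable_add summable_mult m6 s2 s4)
  have u0: "u n \<ge> 0" for n
    unfolding u_def by (intro add_nonneg_nonneg mult_nonneg_nonneg) (auto simp: r_def m_def)
  have step: "- ln (1 - (a (n + 3))\<^sup>2) / 2
      + szego_increment (a (n + 3)) (a (n + 2)) (a (n + 1)) (a n) \<le> G (Suc n) - G n + u n" for n
  proof -
    have m: "\<bar>a (n + 3)\<bar> \<le> m n" "\<bar>a (n + 2)\<bar> \<le> m n" "\<bar>a (n + 1)\<bar> \<le> m n" "\<bar>a n\<bar> \<le> m n"
      unfolding m_def by linarith+
    let ?q = "cofactor (a (n + 3)) (a (n + 2)) (a (n + 1)) (a n)"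
    have "?q\<^sup>2 = \<bar>?q\<bar>\<^sup>2" by simp
    also have "\<dots> \<le> (4 * m n ^ 3)\<^sup>2" by (intro power_mono cofactor_bound m) auto
    also have "\<dots> = 16 * m n ^ 6" by (simp add: power_mult_distrib flip: power_mult)
    finally have q: "?q\<^sup>2 \<le> 16 * m n ^ 6" .
    \<comment> \<open>Young's inequality: \<open>E\<close> is only square summable, but
      \<open>cofactor\<close> is cubic, so its square is dominated by the summable
      \<open>m n ^ 6\<close>.\<close>
    have "0 \<le> (E n - ?q)\<^sup>2" by simp
    then have Eq: "E n * ?q \<le> (E n)\<^sup>2 / 2 + ?q\<^sup>2 / 2" by (simp add: power2_diff)
    have sx: "sextic (a (n + 3)) (a (n + 2)) (a (n + 1)) (a n) \<le> m n ^ 6"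
      using sextic_bound[OF m] by linarith
    have rn: "- ln (1 - (a (n + 3))\<^sup>2) / 2 - (a (n + 3))\<^sup>2 / 2 - a (n + 3) ^ 4 / 4 \<le> r n"
      by (simp add: r_def)
    have nonneg: "0 \<le> (E n)\<^sup>2" "0 \<le> \<gamma> n ^ 4" "0 \<le> m n ^ 6" by (simp_all add: m_def)
    have "G (Suc n) = cobound (a (n + 3)) (a (n + 2)) (a (n + 1))"
      by (simp add: G_def eval_nat_numeral)
    then have decomp: "szego_increment (a (n + 3)) (a (n + 2)) (a (n + 1)) (a n)
        + (a (n + 3))\<^sup>2 / 2 + a (n + 3) ^ 4 / 4
        = (E n)\<^sup>2 / 8 + \<gamma> n ^ 4 / 128 + (G (Suc n) - G n) + E n * ?q
          + sextic (a (n + 3)) (a (n + 2)) (a (n + 1)) (a n)"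
      unfolding E_def \<gamma>_def G_def[of n] by (simp only: szego_increment_decomp)
    have lin: "l + s \<le> G1 - G0 + (e + g + 17 * m6 + r')"
      if "s + x2 / 2 + x4 / 4 = e / 8 + g / 128 + (G1 - G0) + eq + sx" "eq \<le> e / 2 + q / 2"
        "q \<le> 16 * m6" "sx \<le> m6" "l - x2 / 2 - x4 / 4 \<le> r'" "0 \<le> e" "0 \<le> g" "0 \<le> m6"
      for l s G1 G0 e g m6 r' x2 x4 eq sx q :: real
      using that by linarith
    show ?thesis
      unfolding u_def by (rule lin[OF decomp Eq q sx rn nonneg])
  qed
  have GB: "\<bar>G n\<bar> \<le> 4" for n
    unfolding G_def using a1 by (intro cobound_bound less_imp_le)
  show ?thesis
  proof (rule that)
    fix N
    have "(\<Sum>n<N. - ln (1 - (a (n + 3))\<^sup>2) / 2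
        + szego_increment (a (n + 3)) (a (n + 2)) (a (n + 1)) (a n))
        \<le> (\<Sum>n<N. G (Suc n) - G n + u n)"
      by (intro sum_mono step)
    also have "\<dots> = G N - G 0 + (\<Sum>n<N. u n)"
      by (simp only: sum.distrib sum_lessThan_telescope)
    also have "\<dots> \<le> 8 + suminf u"
      using GB[of N] GB[of 0] sum_le_suminf[OF su, of "{..<N}"] u0 by auto
    finally show "(\<Sum>n<N. - ln (1 - (a (n + 3))\<^sup>2) / 2
        + szego_increment (a (n + 3)) (a (n + 2)) (a (n + 1)) (a n)) \<le> 8 + suminf u" .
  qed
qed

section \<open>The Szego recursion\<close>

text \<open>Only the algebra of the recursion. The bound on the coefficients and the measure enter
  in the locales built on top of this one.\<close>

locale szego_recursion =
  fixes \<Phi> :: "nat \<Rightarrow> complex poly" and \<alpha> :: "nat \<Rightarrow> complex"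
  assumes degree_Phi: "degree (\<Phi> n) = n"
    and lead_Phi: "lead_coeff (\<Phi> n) = 1"
    and Phi_Suc: "\<Phi> (Suc n) = [:0, 1:] * \<Phi> n - smult (cnj (\<alpha> n)) (reversed_poly (\<Phi> n))"
begin

abbreviation rev_Phi :: "nat \<Rightarrow> complex poly" where
  "rev_Phi n \<equiv> reversed_poly (\<Phi> n)"

lemma Phi_0: "\<Phi> 0 = 1"
  using degree_Phi[of 0] lead_Phi[of 0] by (auto elim: degree_eq_zeroE simp: one_pCons)

lemma rev_Phi_0: "rev_Phi 0 = 1"
  by (simp add: Phi_0 reversed_poly_def map_poly_1)

lemma poly_rev_Phi: "z \<noteq> 0 \<Longrightarrow> poly (rev_Phi n) z = z ^ n * cnj (poly (\<Phi> n) (1 / cnj z))"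
  by (rule poly_reversed_poly[OF degree_Phi])

text \<open>Reflecting the recursion for \<Phi> in the unit circle gives the identity at every
  nonzero point, and a polynomial with infinitely many zeros is zero.\<close>

lemma rev_Phi_Suc: "rev_Phi (Suc n) = rev_Phi n - smult (\<alpha> n) ([:0, 1:] * \<Phi> n)"
proof -
  let ?p = "rev_Phi (Suc n) - (rev_Phi n - smult (\<alpha> n) ([:0, 1:] * \<Phi> n))"
  have "poly ?p z = 0" if "z \<noteq> 0" for z
  proof -
    define w where "w = 1 / cnj z"
    have w: "w \<noteq> 0" "1 / cnj w = z" "cnj w = 1 / z" using that by (simp_all add: w_def)
    have "poly (rev_Phi (Suc n)) z = z ^ Suc n * cnj (poly (\<Phi> (Suc n)) w)"
      unfolding w_def by (rule poly_rev_Phi[OF that])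
    also have "poly (\<Phi> (Suc n)) w = w * poly (\<Phi> n) w - cnj (\<alpha> n) * (w ^ n * cnj (poly (\<Phi> n) z))"
      using poly_rev_Phi[OF w(1), of n] by (simp add: Phi_Suc w(2))
    also have "z ^ Suc n * cnj \<dots> = z ^ n * cnj (poly (\<Phi> n) w) - \<alpha> n * z * poly (\<Phi> n) z"
      using that by (simp add: w(3) field_simps)
    also have "z ^ n * cnj (poly (\<Phi> n) w) = poly (rev_Phi n) z"
      unfolding w_def by (rule poly_rev_Phi[OF that, symmetric])
    finally show ?thesis by simp
  qed
  then have "UNIV - {0} \<subseteq> {z. poly ?p z = 0}" by blast
  moreover have "infinite (UNIV - {0 :: complex})" by (simp add: infinite_UNIV_char_0)
  ultimately have "infinite {z. poly ?p z = 0}" by (meson infinite_super)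
  then have "?p = 0" using poly_roots_finite by blast
  then show ?thesis by simp
qed

lemma poly_rev_Phi_circle:
  assumes "norm z = 1"
  shows "poly (rev_Phi n) z = z ^ n * cnj (poly (\<Phi> n) z)"
proof -
  have "z * cnj z = 1" using assms by (simp add: complex_norm_square[symmetric])
  then have "1 / cnj z = z" "z \<noteq> 0" by (auto simp: divide_eq_eq)
  then show ?thesis using poly_rev_Phi[of z n] by simp
qed

lemma norm_rev_Phi_circle: "norm z = 1 \<Longrightarrow> norm (poly (rev_Phi n) z) = norm (poly (\<Phi> n) z)"
  by (simp add: poly_rev_Phi_circle norm_mult norm_power)

lemma rev_Phi_at_0: "poly (rev_Phi n) 0 = 1"
proof (induction n)
  case (Suc n)
  then show ?case by (simp add: rev_Phi_Suc)
qed (simp add: rev_Phi_0)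

lemma coeff_rev_Phi_0: "coeff (rev_Phi n) 0 = 1"
  using rev_Phi_at_0 by (simp add: poly_0_coeff_0)

lemma coeff_rev_Phi_Suc:
  "coeff (rev_Phi (Suc n)) (Suc k) = coeff (rev_Phi n) (Suc k) - \<alpha> n * coeff (\<Phi> n) k"
  by (simp add: rev_Phi_Suc coeff_pCons)

lemma coeff_Phi_Suc_0: "coeff (\<Phi> (Suc n)) 0 = - cnj (\<alpha> n)"
  by (simp add: Phi_Suc coeff_rev_Phi_0)

lemma coeff_Phi_Suc_Suc:
  "coeff (\<Phi> (Suc n)) (Suc k) = coeff (\<Phi> n) k - cnj (\<alpha> n) * coeff (rev_Phi n) (Suc k)"
  by (simp add: Phi_Suc coeff_pCons)

text \<open>With \<open>p = z * poly (\<Phi> n) z\<close> and \<open>q = poly (rev_Phi n) z\<close>,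
  the difference of the squared moduli of q - \<alpha> p and p - cnj \<alpha> q is (1 -
  |\<alpha>|^2)(|q|^2 - |p|^2). So the domination of \<Phi> by its reversal passes from one index to
  the next, and then |\<alpha> p| < |q| excludes a zero.\<close>

lemma poly_rev_Phi_nonzero:
  assumes \<alpha>: "\<And>k. norm (\<alpha> k) < 1" and z: "norm z \<le> 1"
  shows "norm (poly (\<Phi> n) z) \<le> norm (poly (rev_Phi n) z) \<and> poly (rev_Phi n) z \<noteq> 0"
proof (induction n)
  case 0
  show ?case unfolding rev_Phi_0 by (simp add: Phi_0)
next
  case (Suc n)
  define p where "p = z * poly (\<Phi> n) z"
  define q where "q = poly (rev_Phi n) z"
  have Suc_eq: "poly (\<Phi> (Suc n)) z = p - cnj (\<alpha> n) * q" "poly (rev_Phi (Suc n)) z = q - \<alpha> n * p"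
    by (simp add: Phi_Suc p_def q_def, simp add: rev_Phi_Suc p_def q_def)
  have "norm p \<le> 1 * norm (poly (\<Phi> n) z)"
    unfolding p_def norm_mult using z by (intro mult_right_mono) auto
  then have pq: "norm p \<le> norm q" "q \<noteq> 0" using Suc unfolding q_def by auto
  have "(norm (q - \<alpha> n * p))\<^sup>2 - (norm (p - cnj (\<alpha> n) * q))\<^sup>2
      = (1 - (norm (\<alpha> n))\<^sup>2) * ((norm q)\<^sup>2 - (norm p)\<^sup>2)"
    unfolding cmod_power2 by (simp add: algebra_simps power2_eq_square)
  also have "\<dots> \<ge> 0"
    using \<alpha>[of n] pq(1) by (intro mult_nonneg_nonneg) (auto simp: power_le_one abs_square_le_1 power_mono)
  finally have "(norm (p - cnj (\<alpha> n) * q))\<^sup>2 \<le> (norm (q - \<alpha> n * p))\<^sup>2" by simp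
  then have "norm (p - cnj (\<alpha> n) * q) \<le> norm (q - \<alpha> n * p)"
    by (rule power2_le_imp_le) simp
  moreover have "q - \<alpha> n * p \<noteq> 0"
  proof
    assume "q - \<alpha> n * p = 0"
    then have "norm q = norm (\<alpha> n) * norm p" by (metis eq_iff_diff_eq_0 norm_mult)
    also have "\<dots> \<le> norm (\<alpha> n) * norm q" using pq(1) by (intro mult_left_mono) auto
    also have "\<dots> < 1 * norm q" using \<alpha>[of n] pq(2) by (intro mult_strict_right_mono) auto
    finally show False by simp
  qed
  ultimately show ?case unfolding Suc_eq by blast
qed

text \<open>The third-order Taylor coefficients of \<open>log \<Phi>\<^sub>n\<^sup>*\<close>, weighted with the Fourier coefficients of
  \<open>(1 - cos \<theta>)\<^sup>2 (1 + cos \<theta>) = 1/2 - cos \<theta> / 4 - cos (2\<theta>) / 2 + cos (3\<theta>) / 4\<close>.\<close>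

definition log_moment :: "nat \<Rightarrow> complex" where
  "log_moment n = (let p1 = coeff (rev_Phi n) 1; p2 = coeff (rev_Phi n) 2; p3 = coeff (rev_Phi n) 3
     in - p1 / 4 - (p2 - p1\<^sup>2 / 2) / 2 + (p3 - p1 * p2 + p1 ^ 3 / 3) / 4)"

text \<open>Although the low coefficients of \<open>rev_Phi\<close> accumulate the whole history,
  that history cancels in the increment of the logarithm, and only the four latest coefficients
  survive. The offset 3 ensures that four coefficients exist.\<close>

lemma log_moment_Suc:
  assumes \<alpha>: "\<And>k. \<alpha> k = complex_of_real (a k)"
  shows "log_moment (n + 4) = log_moment (n + 3)
     + complex_of_real (szego_increment (a (n + 3)) (a (n + 2)) (a (n + 1)) (a n))"
proof -
  \<comment> \<open>These three coefficients carry the history; everything else is unfolded down to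
    index \<open>n\<close>.\<close>
  define u v q where "u = coeff (rev_Phi (Suc n)) 1" and "v = coeff (rev_Phi (n + 2)) 2"
    and "q = coeff (rev_Phi (n + 3)) 3"
  have ix: "n + 2 = Suc (Suc n)" "n + 3 = Suc (Suc (Suc n))" "n + 4 = Suc (Suc (Suc (Suc n)))"
    "(1::nat) = Suc 0" "(2::nat) = Suc (Suc 0)" "(3::nat) = Suc (Suc (Suc 0))" "n + 1 = Suc n"
    by simp_all
  note [simp] = coeff_rev_Phi_Suc coeff_Phi_Suc_0 coeff_Phi_Suc_Suc \<alpha>
  have c1: "coeff (rev_Phi (n + 3)) 1 = u + of_real (a (n + 1) * a n + a (n + 2) * a (n + 1))"
    unfolding u_def ix by simp
  have c2: "coeff (rev_Phi (n + 3)) 2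
      = v + of_real (a (n + 2)) * (of_real (a n) + of_real (a (n + 1)) * u)"
    unfolding u_def v_def ix by (simp add: algebra_simps)
  have d1: "coeff (rev_Phi (n + 4)) 1 = coeff (rev_Phi (n + 3)) 1 + of_real (a (n + 3) * a (n + 2))"
    unfolding ix by simp
  have d2: "coeff (rev_Phi (n + 4)) 2 = coeff (rev_Phi (n + 3)) 2
      + of_real (a (n + 3)) * (of_real (a (n + 1)) + of_real (a (n + 2)) * (u + of_real (a (n + 1) * a n)))"
    unfolding u_def ix by (simp add: algebra_simps)
  have d3: "coeff (rev_Phi (n + 4)) 3 = q + of_real (a (n + 3)) *
      (of_real (a n) + of_real (a (n + 1)) * u + of_real (a (n + 2)) * v)"
    unfolding u_def v_def q_def ix by (simp add: algebra_simps)
  show ?thesis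
    unfolding log_moment_def Let_def d1 d2 d3 c1 c2 q_def[symmetric] szego_increment_def
    by (simp add: field_simps power2_eq_square power3_eq_cube)
qed

end

section \<open>Integrals over the circle\<close>

lemma prob_space_angle_measure: "prob_space angle_measure"
  unfolding angle_measure_def by (rule prob_space_uniform_measure) auto

lemma sets_angle_measure [simp, measurable_cong]: "sets angle_measure = sets borel"
  by (simp add: angle_measure_def)

lemma space_angle_measure [simp]: "space angle_measure = UNIV"
  by (simp add: angle_measure_def)

lemma AE_angle_measure:
  assumes "\<And>\<theta>. \<theta> \<in> {0..<2 * pi} \<Longrightarrow> P \<theta>"
  shows "AE \<theta> in angle_measure. P \<theta>"
  unfolding angle_measure_def
  by (subst AE_uniform_measure) (use assms in auto)

lemma integrable_angle_measure:
  fixes f :: "real \<Rightarrow> 'a :: {banach, second_countable_topology}"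
  assumes "continuous_on UNIV f"
  shows "integrable angle_measure f"
proof -
  interpret prob_space angle_measure by (rule prob_space_angle_measure)
  have "compact (f ` {0..2 * pi})"
    by (rule compact_continuous_image[OF continuous_on_subset[OF assms subset_UNIV] compact_Icc])
  then have "bounded (f ` {0..2 * pi})" by (rule compact_imp_bounded)
  then obtain B where "\<forall>x\<in>f ` {0..2 * pi}. norm x \<le> B"
    unfolding bounded_iff ..
  then have B: "\<forall>\<theta>\<in>{0..2 * pi}. norm (f \<theta>) \<le> B" by simp
  have "f \<in> borel_measurable borel" using assms by (rule borel_measurable_continuous_onI)
  then show ?thesis
    by (intro integrable_const_bound[where B = B] AE_angle_measure) (use B in auto)
qed

text \<open>Connects contour integrals, which are gauge integrals over the closed interval, with
  \<open>angle_measure\<close>; the extra endpoint is a null set.\<close>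

lemma integral_angle_measure:
  fixes f :: "real \<Rightarrow> complex"
  assumes cont: "continuous_on UNIV f" and int: "(f has_integral I) {0..2 * pi}"
  shows "(\<integral>\<theta>. f \<theta> \<partial>angle_measure) = I / (2 * pi)"
proof -
  have meas: "f \<in> borel_measurable borel" using cont by (rule borel_measurable_continuous_onI)
  have si: "set_integrable lborel {0..2 * pi} f"
    by (rule borel_integrable_atLeastAtMost'[OF continuous_on_subset[OF cont subset_UNIV]])
  have dens: "angle_measure = density lborel (\<lambda>\<theta>. ennreal (indicator {0..<2 * pi} \<theta> / (2 * pi)))"
    unfolding angle_measure_def uniform_measure_def
  proof (rule density_cong)
    show "AE \<theta> in lborel. indicator {0..<2 * pi} \<theta> / emeasure lborel {0..<2 * pi}
        = ennreal (indicator {0..<2 * pi} \<theta> / (2 * pi))"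
      by (rule AE_I2) (simp add: indicator_def divide_ennreal[symmetric])
  qed measurable
  have "(\<integral>\<theta>. f \<theta> \<partial>angle_measure) = (\<integral>\<theta>. (indicator {0..<2 * pi} \<theta> / (2 * pi)) *\<^sub>R f \<theta> \<partial>lborel)"
    unfolding dens
  proof (rule integral_density)
    show "f \<in> borel_measurable lborel" using meas by simp
  qed simp_all
  also have "\<dots> = (\<integral>\<theta>. inverse (2 * pi) *\<^sub>R (indicator {0..<2 * pi} \<theta> *\<^sub>R f \<theta>) \<partial>lborel)"
    unfolding scaleR_scaleR divide_inverse mult.commute[of "inverse (2 * pi)"] ..
  also have "\<dots> = inverse (2 * pi) *\<^sub>R (\<integral>\<theta>. indicator {0..<2 * pi} \<theta> *\<^sub>R f \<theta> \<partial>lborel)"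
    by (rule integral_scaleR_right)
  also have "(\<integral>\<theta>. indicator {0..<2 * pi} \<theta> *\<^sub>R f \<theta> \<partial>lborel) = (\<integral>\<theta>. indicator {0..2 * pi} \<theta> *\<^sub>R f \<theta> \<partial>lborel)"
  proof (rule integral_cong_AE)
    show "AE \<theta> in lborel. indicator {0..<2 * pi} \<theta> *\<^sub>R f \<theta> = indicator {0..2 * pi} \<theta> *\<^sub>R f \<theta>"
      using AE_lborel_singleton[of "2 * pi"] by eventually_elim (auto simp: indicator_def)
  qed (use meas in measurable)
  also have "\<dots> = I"
    using set_borel_integral_eq_integral(2)[OF si] integral_unique[OF int]
    unfolding set_lebesgue_integral_def by simp
  finally show ?thesis by (simp add: scaleR_conv_of_real field_simps)
qed

text \<open>Cauchy's formula for the \<open>k\<close>-th derivative over the unit circle, where the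
  conjugate of \<open>cis \<theta>\<close> is its inverse.\<close>

lemma integral_cis_Taylor:
  assumes holo: "f holomorphic_on S" and S: "open S" "cball 0 1 \<subseteq> S"
  shows "(\<integral>\<theta>. cnj (cis \<theta>) ^ k * f (cis \<theta>) \<partial>angle_measure) = (deriv ^^ k) f 0 / fact k"
proof -
  have cont: "continuous_on (cball 0 1) f"
    by (rule continuous_on_subset[OF holomorphic_on_imp_continuous_on[OF holo] S(2)])
  have "f holomorphic_on ball 0 1"
    by (rule holomorphic_on_subset[OF holo order.trans[OF ball_subset_cball S(2)]])
  from Cauchy_has_contour_integral_higher_derivative_circlepath[OF cont this, of 0 k]
  have "((\<lambda>t. f (cis t) / cis t ^ Suc k * \<i> * cis t) has_integral
      2 * pi * \<i> / fact k * (deriv ^^ k) f 0) {0..2 * pi}"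
    unfolding circlepath_def by (simp add: has_contour_integral_part_circlepath_iff)
  then have int: "((\<lambda>t. \<i> * (cnj (cis t) ^ k * f (cis t))) has_integral
      2 * pi * \<i> / fact k * (deriv ^^ k) f 0) {0..2 * pi}"
  proof (rule has_integral_eq[rotated])
    fix t
    have "cnj (cis t) = 1 / cis t" by (simp add: cis_cnj cis_inverse flip: inverse_eq_divide)
    then show "f (cis t) / cis t ^ Suc k * \<i> * cis t = \<i> * (cnj (cis t) ^ k * f (cis t))"
      by (simp add: power_divide)
  qed
  have cancel: "b * x / b = x" "a * b / c * d / b = a / c * d" if "b \<noteq> 0" for a b c d x :: complex
    using that by simp_all
  have "((\<lambda>t. cnj (cis t) ^ k * f (cis t)) has_integral of_real (2 * pi) / fact k * (deriv ^^ k) f 0) {0..2 * pi}"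
    using has_integral_divide[OF int, of "\<i>"]
    unfolding cancel(1)[OF complex_i_not_zero] cancel(2)[OF complex_i_not_zero] .
  moreover have "continuous_on UNIV (\<lambda>t. cnj (cis t) ^ k * f (cis t))"
    by (intro continuous_intros continuous_on_compose2[OF cont]) auto
  ultimately have "(\<integral>\<theta>. cnj (cis \<theta>) ^ k * f (cis \<theta>) \<partial>angle_measure)
      = of_real (2 * pi) / fact k * (deriv ^^ k) f 0 / of_real (2 * pi)"
    by (intro integral_angle_measure)
  then show ?thesis by simp
qed

text \<open>The mean value property of \<open>z ^ k * f z\<close>, which vanishes at the
  center.\<close>

lemma integral_cis_power:
  assumes "f holomorphic_on S" "open S" "cball 0 1 \<subseteq> S" "0 < k"
  shows "(\<integral>\<theta>. cis \<theta> ^ k * f (cis \<theta>) \<partial>angle_measure) = 0"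
proof -
  have "(\<lambda>z. z ^ k * f z) holomorphic_on S" using assms(1) by (intro holomorphic_intros)
  from integral_cis_Taylor[OF this assms(2,3), of 0] show ?thesis using assms(4) by simp
qed

section \<open>The weight Q and its Fourier expansion\<close>

definition szego_weight :: "real \<Rightarrow> real" where
  "szego_weight \<theta> = (1 - cos \<theta>)\<^sup>2 * (1 + cos \<theta>)"

lemma szego_weight_nonneg: "0 \<le> szego_weight \<theta>"
  unfolding szego_weight_def using cos_ge_minus_one[of \<theta>] by (intro mult_nonneg_nonneg) (simp, linarith)

text \<open>One factor 1 - cos \<theta> and the factor 1 + cos \<theta> combine to the square of the
  sine. This bound is the source of the factor 2 in the entropy inequalities.\<close>

lemma szego_weight_le_2: "szego_weight \<theta> \<le> 2"
proof -
  have "szego_weight \<theta> = (1 - cos \<theta>) * (sin \<theta>)\<^sup>2"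
    unfolding szego_weight_def sin_squared_eq by (simp add: algebra_simps power2_eq_square)
  also have "\<dots> \<le> 2 * 1"
    using cos_ge_minus_one[of \<theta>] abs_sin_le_one[of \<theta>] by (intro mult_mono) (auto simp: abs_square_le_1)
  finally show ?thesis by simp
qed

lemma continuous_on_szego_weight [continuous_intros]: "continuous_on A szego_weight"
  unfolding szego_weight_def by (intro continuous_intros)

lemma cis_mult_cnj [simp]: "cis \<theta> * cnj (cis \<theta>) = 1" "cnj (cis \<theta>) * cis \<theta> = 1"
  by (simp_all add: cis_cnj cis_mult)

text \<open>Only frequencies up to three occur, which is why three Taylor coefficients of the
  logarithm suffice.\<close>

lemma szego_weight_cis:
  "complex_of_real (szego_weight \<theta>) = 1 / 2 - (cis \<theta> + cnj (cis \<theta>)) / 8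
     - (cis \<theta> ^ 2 + cnj (cis \<theta>) ^ 2) / 4 + (cis \<theta> ^ 3 + cnj (cis \<theta>) ^ 3) / 8"
proof -
  define z y where "z = cis \<theta>" and "y = cnj (cis \<theta>)"
  have zy: "z * y = 1" by (simp add: z_def y_def)
  have c: "complex_of_real (cos \<theta>) = (z + y) / 2"
    by (simp add: z_def y_def complex_eq_iff)
  have "z ^ 2 + y ^ 2 = (z + y) ^ 2 - 2 * (z * y)" "z ^ 3 + y ^ 3 = (z + y) ^ 3 - 3 * (z * y) * (z + y)"
    by (simp_all add: algebra_simps power2_eq_square power3_eq_cube)
  then have p: "z ^ 2 + y ^ 2 = (z + y) ^ 2 - 2" "z ^ 3 + y ^ 3 = (z + y) ^ 3 - 3 * (z + y)"
    unfolding zy by simp_all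
  have "complex_of_real (szego_weight \<theta>) = (1 - (z + y) / 2) ^ 2 * (1 + (z + y) / 2)"
    unfolding szego_weight_def by (simp add: c)
  also have "\<dots> = 1 / 2 - (z + y) / 8 - ((z + y) ^ 2 - 2) / 4 + ((z + y) ^ 3 - 3 * (z + y)) / 8"
    by (simp add: field_simps power2_eq_square power3_eq_cube)
  finally show ?thesis unfolding p[symmetric] by (simp add: z_def y_def)
qed

text \<open>Each negative frequency of the weight picks out a Taylor coefficient of
  \<open>h\<close>; the positive frequencies integrate to zero. In \<open>2 / 4\<close> and
  \<open>6 / 8\<close> the first number is the factorial and the second comes from the Fourier
  coefficient.\<close>

lemma integral_szego_weight_holomorphic:
  fixes h :: "complex \<Rightarrow> complex"
  assumes holo: "h holomorphic_on S" and S: "open S" "cball 0 1 \<subseteq> S"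
  shows "(\<integral>\<theta>. szego_weight \<theta> * h (cis \<theta>) \<partial>angle_measure)
    = h 0 / 2 - deriv h 0 / 8 - (deriv ^^ 2) h 0 / 2 / 4 + (deriv ^^ 3) h 0 / 6 / 8"
proof -
  define I where "I k \<theta> = cnj (cis \<theta>) ^ k * h (cis \<theta>)" for k \<theta>
  define J where "J k \<theta> = cis \<theta> ^ k * h (cis \<theta>)" for k \<theta>
  have "continuous_on (cball 0 1) h"
    using holomorphic_on_imp_continuous_on[OF holo] S(2) by (rule continuous_on_subset)
  then have "continuous_on UNIV (\<lambda>\<theta>. h (cis \<theta>))"
    by (rule continuous_on_compose2) (auto intro: continuous_intros)
  then have int: "integrable angle_measure (I k)" "integrable angle_measure (J k)" for k
    unfolding I_def J_def by (intro integrable_angle_measure continuous_intros; assumption)+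
  have I: "(\<integral>\<theta>. I k \<theta> \<partial>angle_measure) = (deriv ^^ k) h 0 / fact k" for k
    unfolding I_def by (rule integral_cis_Taylor[OF holo S])
  have J: "(\<integral>\<theta>. J k \<theta> \<partial>angle_measure) = 0" if "k > 0" for k
    unfolding J_def by (rule integral_cis_power[OF holo S that])
  have "szego_weight \<theta> * h (cis \<theta>) = 1 / 2 * I 0 \<theta> - 1 / 8 * J 1 \<theta> - 1 / 8 * I 1 \<theta>
      - 1 / 4 * J 2 \<theta> - 1 / 4 * I 2 \<theta> + 1 / 8 * J 3 \<theta> + 1 / 8 * I 3 \<theta>" for \<theta>
    unfolding szego_weight_cis I_def J_def by (simp add: field_simps)
  then have "(\<integral>\<theta>. szego_weight \<theta> * h (cis \<theta>) \<partial>angle_measure)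
      = (\<integral>\<theta>. 1 / 2 * I 0 \<theta> - 1 / 8 * J 1 \<theta> - 1 / 8 * I 1 \<theta>
      - 1 / 4 * J 2 \<theta> - 1 / 4 * I 2 \<theta> + 1 / 8 * J 3 \<theta> + 1 / 8 * I 3 \<theta> \<partial>angle_measure)"
    by presburger
  also have "\<dots> = 1 / 2 * (deriv ^^ 0) h 0 / fact 0 - 1 / 8 * ((deriv ^^ 1) h 0 / fact 1)
      - 1 / 4 * ((deriv ^^ 2) h 0 / fact 2) + 1 / 8 * ((deriv ^^ 3) h 0 / fact 3)"
    using int by (simp add: I J)
  finally show ?thesis by (simp add: fact_numeral)
qed

section \<open>Logarithms of polynomials without zeros in the closed disk\<close>

lemma nonvanishing_on_larger_ball:
  fixes p :: "complex poly"
  assumes "\<And>z. norm z \<le> 1 \<Longrightarrow> poly p z \<noteq> 0"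
  obtains r where "r > 1" "\<And>z. z \<in> ball 0 r \<Longrightarrow> poly p z \<noteq> 0"
proof -
  have "open {z. poly p z \<noteq> 0}"
    by (intro open_Collect_neq continuous_intros)
  moreover have "cball 0 1 \<subseteq> {z. poly p z \<noteq> 0}" using assms by auto
  ultimately obtain \<epsilon> where \<epsilon>: "\<epsilon> > 0" "(\<Union>x\<in>cball 0 1. ball x \<epsilon>) \<subseteq> {z. poly p z \<noteq> 0}"
    using compact_subset_open_imp_ball_epsilon_subset[OF compact_cball] by metis
  show ?thesis
  proof (rule that)
    fix z :: complex assume z: "z \<in> ball 0 (1 + \<epsilon>)"
    show "poly p z \<noteq> 0"
    proof (cases "norm z \<le> 1")
      case False
      \<comment> \<open>The radial projection to the circle has distance \<open>norm z - 1\<close>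
        from \<open>z\<close>, which is less than \<epsilon>.\<close>
      define x where "x = z /\<^sub>R norm z"
      have "norm z *\<^sub>R x = z" unfolding x_def using False by (auto simp: field_simps)
      then have "z - x = (norm z - 1) *\<^sub>R (z /\<^sub>R norm z)"
        unfolding x_def[symmetric] by (simp add: scaleR_diff_left)
      then have "norm (z - x) = norm z - 1" using False by (auto simp: divide_inverse[symmetric])
      then have "z \<in> ball x \<epsilon>" using z by (simp add: dist_norm norm_minus_commute)
      moreover have "x \<in> cball 0 1" using False by (auto simp: x_def field_simps)
      ultimately show ?thesis using \<epsilon>(2) by blast
    qed (rule assms)
  qed (use \<epsilon> in simp)
qed

text \<open>On a disk slightly larger than the unit disk, p = exp h with h holomorphic, so ln |p| is
  the real part of h. Comparing power series in h' p = p' expresses the Taylor coefficients of h by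
  those of p.\<close>

lemma integral_szego_weight_ln_poly:
  fixes p :: "complex poly"
  assumes nz: "\<And>z. norm z \<le> 1 \<Longrightarrow> poly p z \<noteq> 0" and p0: "poly p 0 = 1"
  defines "p1 \<equiv> coeff p 1" and "p2 \<equiv> coeff p 2" and "p3 \<equiv> coeff p 3"
  shows "(\<integral>\<theta>. szego_weight \<theta> * ln (norm (poly p (cis \<theta>))) \<partial>angle_measure)
    = Re (- p1 / 4 - (p2 - p1\<^sup>2 / 2) / 2 + (p3 - p1 * p2 + p1 ^ 3 / 3) / 4) / 2"
proof -
  obtain r where r: "r > 1" "\<And>z. z \<in> ball 0 r \<Longrightarrow> poly p z \<noteq> 0"
    using nonvanishing_on_larger_ball[OF nz] by metis
  define S where "S = ball (0 :: complex) r"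
  have S: "open S" "cball 0 1 \<subseteq> S" "0 \<in> S" "convex S" using r by (auto simp: S_def)
  have "(\<lambda>z. poly p z) holomorphic_on S" by (intro holomorphic_intros)
  then obtain h where h: "h holomorphic_on S" "\<And>z. z \<in> S \<Longrightarrow> exp (h z) = poly p z"
    using holomorphic_logarithm_exists[OF S(4,1), of "poly p" 0] r(2) S(3) unfolding S_def by metis
  define H where "H = fps_expansion h 0"
  have H: "h has_fps_expansion H"
    unfolding H_def using h(1) S by (intro has_fps_expansion_fps_expansion) auto
  have P: "poly p has_fps_expansion fps_of_poly p"
    by (simp add: has_fps_expansion_def)
  have deriv_eq: "deriv h z * poly p z = deriv (poly p) z" if "z \<in> S" for z
  proof -
    have "((\<lambda>z. exp (h z)) has_field_derivative exp (h z) * deriv h z) (at z)"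
      using holomorphic_derivI[OF h(1) S(1) that] by (auto intro!: derivative_eq_intros)
    then have "(poly p has_field_derivative exp (h z) * deriv h z) (at z)"
      by (rule has_field_derivative_transform_within_open[OF _ S(1) that]) (use h(2) in auto)
    then show ?thesis using h(2)[OF that] by (simp add: DERIV_imp_deriv mult.commute)
  qed
  have prod: "(\<lambda>z. deriv h z * poly p z) has_fps_expansion fps_deriv H * fps_of_poly p"
    by (intro has_fps_expansion_mult has_fps_expansion_deriv H P)
  have ev: "\<forall>\<^sub>F z in nhds 0. deriv h z * poly p z = deriv (poly p) z"
    using eventually_nhds_in_open[OF S(1,3)] by eventually_elim (rule deriv_eq)
  have "deriv (poly p) has_fps_expansion fps_deriv H * fps_of_poly p"
    using prod has_fps_expansion_cong[OF ev refl] by (rule iffD1[rotated])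
  then have eq: "fps_deriv H * fps_of_poly p = fps_deriv (fps_of_poly p)"
    using has_fps_expansion_deriv[OF P] fps_expansion_unique_complex by blast
  have c0: "coeff p 0 = 1" using p0 by (simp add: poly_0_coeff_0)
  have cf: "fps_nth (fps_deriv H * fps_of_poly p) k = fps_nth (fps_deriv (fps_of_poly p)) k" for k
    by (simp only: eq)
  \<comment> \<open>The coefficients of orders 0, 1 and 2 of h' p = p' determine those of orders 1,
    2 and 3 of h.\<close>
  have h1: "fps_nth H 1 = p1"
    using cf[of 0] by (simp add: fps_mult_nth c0 p1_def)
  have h2: "2 * fps_nth H 2 + p1 * p1 = 2 * p2"
    using cf[of 1] h1 by (simp add: fps_mult_nth c0 p1_def p2_def numeral_2_eq_2 add.commute)
  have h3: "3 * fps_nth H 3 + 2 * fps_nth H 2 * p1 + p1 * p2 = 3 * p3"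
    using cf[of 2] h1 by (simp add: fps_mult_nth c0 p1_def p2_def p3_def numeral_2_eq_2 numeral_3_eq_3 algebra_simps)
  have h2': "fps_nth H 2 = p2 - p1\<^sup>2 / 2"
    using h2 by (simp add: field_simps power2_eq_square)
  have h3': "fps_nth H 3 = p3 - p1 * p2 + p1 ^ 3 / 3"
  proof -
    have "2 * fps_nth H 2 = 2 * p2 - p1 * p1" using h2 by (simp add: algebra_simps)
    from h3[unfolded this] have "3 * fps_nth H 3 = 3 * p3 - p1 * p2 - (2 * p2 - p1 * p1) * p1"
      by (simp add: algebra_simps)
    then show ?thesis by (simp add: field_simps power3_eq_cube)
  qed
  have Hk: "(deriv ^^ k) h 0 = fact k * fps_nth H k" for k
    using fps_nth_fps_expansion[OF H, of k] by simp
  have d: "deriv h 0 = p1" "(deriv ^^ 2) h 0 / 2 = p2 - p1\<^sup>2 / 2"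
    "(deriv ^^ 3) h 0 / 6 = p3 - p1 * p2 + p1 ^ 3 / 3"
    using Hk[of 1] Hk[of 2] Hk[of 3] h1 h2' h3' by (simp_all add: fact_numeral)
  have norm_p: "ln (norm (poly p z)) = Re (h z)" if "z \<in> S" for z
    using h(2)[OF that, symmetric] by simp
  \<comment> \<open>The branch of the logarithm is arbitrary, but \<open>h 0\<close> is purely
    imaginary and therefore does not contribute.\<close>
  have Reh0: "Re (h 0) = 0" using norm_p[OF S(3)] p0 by simp
  have "continuous_on (cball 0 1) h"
    by (rule continuous_on_subset[OF holomorphic_on_imp_continuous_on[OF h(1)] S(2)])
  then have "continuous_on UNIV (\<lambda>\<theta>. h (cis \<theta>))"
    by (rule continuous_on_compose2) (auto intro: continuous_intros)
  then have int: "integrable angle_measure (\<lambda>\<theta>. szego_weight \<theta> * h (cis \<theta>))"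
    by (intro integrable_angle_measure continuous_intros)
  have cisS: "cis \<theta> \<in> S" for \<theta> using S(2) by (auto simp: subset_iff)
  have "(\<integral>\<theta>. szego_weight \<theta> * ln (norm (poly p (cis \<theta>))) \<partial>angle_measure)
      = (\<integral>\<theta>. Re (szego_weight \<theta> * h (cis \<theta>)) \<partial>angle_measure)"
    by (simp add: norm_p[OF cisS])
  also have "\<dots> = Re (\<integral>\<theta>. szego_weight \<theta> * h (cis \<theta>) \<partial>angle_measure)"
    using int by (rule integral_Re)
  also have "\<dots> = Re (h 0 / 2 + (- p1 / 4 - (p2 - p1\<^sup>2 / 2) / 2 + (p3 - p1 * p2 + p1 ^ 3 / 3) / 4) / 2)"
    unfolding integral_szego_weight_holomorphic[OF h(1) S(1,2)] d
    by (rule arg_cong[where f = Re]) (simp add: field_simps)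
  also have "\<dots> = Re (- p1 / 4 - (p2 - p1\<^sup>2 / 2) / 2 + (p3 - p1 * p2 + p1 ^ 3 / 3) / 4) / 2"
    using Reh0 by simp
  finally show ?thesis .
qed

section \<open>Bernstein--Szego weights\<close>

locale contractive_szego_recursion = szego_recursion +
  assumes norm_alpha: "norm (\<alpha> n) < 1"
begin

lemma rev_Phi_nonzero: "norm z \<le> 1 \<Longrightarrow> poly (rev_Phi n) z \<noteq> 0"
  using poly_rev_Phi_nonzero[OF norm_alpha] by blast

text \<open>The pairing of \<open>q\<close> with \<open>z ^ j\<close> in the Bernstein--Szego
  measure, without the normalizing constant of \<open>bs_weight\<close>.\<close>

definition bs_moment :: "nat \<Rightarrow> nat \<Rightarrow> complex poly \<Rightarrow> complex" where
  "bs_moment n j q =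
     (\<integral>\<theta>. cnj (cis \<theta>) ^ j * poly q (cis \<theta>) / of_real ((norm (poly (rev_Phi n) (cis \<theta>)))\<^sup>2) \<partial>angle_measure)"

lemma integrable_bs_moment:
  "integrable angle_measure
     (\<lambda>\<theta>. cnj (cis \<theta>) ^ j * poly q (cis \<theta>) / of_real ((norm (poly (rev_Phi n) (cis \<theta>)))\<^sup>2))"
  using rev_Phi_nonzero[of "cis _" n] by (intro integrable_angle_measure continuous_intros) auto

lemma bs_moment_add: "bs_moment n j (p + q) = bs_moment n j p + bs_moment n j q"
  unfolding bs_moment_def
  by (subst Bochner_Integration.integral_add[symmetric, OF integrable_bs_moment integrable_bs_moment])
     (simp add: ring_distribs add_divide_distrib)

lemma bs_moment_smult: "bs_moment n j (smult c q) = c * bs_moment n j q"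
  unfolding bs_moment_def by (subst integral_mult_right_zero[symmetric]) (simp add: mult_ac)

text \<open>Multiplication by z is unitary on the circle.\<close>

lemma bs_moment_shift: "bs_moment n (Suc j) ([:0, 1:] * q) = bs_moment n j q"
proof -
  have "cnj (cis \<theta>) ^ Suc j * poly ([:0, 1:] * q) (cis \<theta>) = cnj (cis \<theta>) ^ j * poly q (cis \<theta>)" for \<theta>
  proof -
    have "cnj (cis \<theta>) ^ Suc j * poly ([:0, 1:] * q) (cis \<theta>)
        = (cnj (cis \<theta>) * cis \<theta>) * (cnj (cis \<theta>) ^ j * poly q (cis \<theta>))"
      by (simp add: mult_ac del: cis_mult_cnj)
    then show ?thesis by (simp only: cis_mult_cnj mult_1)
  qed
  then show ?thesis unfolding bs_moment_def by presburger
qed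

lemma rev_Phi_inverse_holomorphic:
  obtains S where "open S" "cball 0 1 \<subseteq> S" "(\<lambda>z. 1 / poly (rev_Phi n) z) holomorphic_on S"
proof (rule that)
  show "open {z. poly (rev_Phi n) z \<noteq> 0}" by (intro open_Collect_neq continuous_intros)
  show "cball 0 1 \<subseteq> {z. poly (rev_Phi n) z \<noteq> 0}" using rev_Phi_nonzero by auto
  show "(\<lambda>z. 1 / poly (rev_Phi n) z) holomorphic_on {z. poly (rev_Phi n) z \<noteq> 0}"
    by (intro holomorphic_intros) auto
qed

lemma integral_cis_power_rev_Phi:
  "(\<integral>\<theta>. cis \<theta> ^ j * (1 / poly (rev_Phi n) (cis \<theta>)) \<partial>angle_measure) = (if j = 0 then 1 else 0)"
proof -
  obtain S where S: "open S" "cball 0 1 \<subseteq> S" "(\<lambda>z. 1 / poly (rev_Phi n) z) holomorphic_on S"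
    by (rule rev_Phi_inverse_holomorphic)
  show ?thesis
  proof (cases "j = 0")
    case True
    then show ?thesis using integral_cis_Taylor[OF S(3,1,2), of 0] by (simp add: rev_Phi_at_0)
  next
    case False
    then show ?thesis using integral_cis_power[OF S(3,1,2), of j] by simp
  qed
qed

text \<open>On the circle, \<open>\<Phi> n\<close> is \<open>z ^ n\<close> times the conjugate of
  \<open>rev_Phi n\<close>. Hence the integrand equals \<open>z ^ (n - j)\<close> divided by
  \<open>rev_Phi n\<close>, a function holomorphic near the closed disk and zero at 0.\<close>

lemma bs_moment_top_Phi:
  assumes "j < n"
  shows "bs_moment n j (\<Phi> n) = 0"
proof -
  have "cnj (cis \<theta>) ^ j * poly (\<Phi> n) (cis \<theta>) / of_real ((norm (poly (rev_Phi n) (cis \<theta>)))\<^sup>2)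
      = cis \<theta> ^ (n - j) * (1 / poly (rev_Phi n) (cis \<theta>))" for \<theta>
  proof -
    define z where "z = cis \<theta>"
    define R where "R = poly (rev_Phi n) z"
    have z: "norm z = 1" "cnj z * z = 1" "cnj z \<noteq> 0" by (simp_all add: z_def)
    have R: "R \<noteq> 0" unfolding R_def by (rule rev_Phi_nonzero) (simp add: z)
    have "cnj R = cnj z ^ n * poly (\<Phi> n) z"
      unfolding R_def using poly_rev_Phi_circle[OF z(1), of n] by simp
    then have "z ^ n * cnj R = (cnj z * z) ^ n * poly (\<Phi> n) z" by (simp add: power_mult_distrib mult_ac)
    then have P: "poly (\<Phi> n) z = z ^ n * cnj R" unfolding z by simp
    have "cnj z ^ j * z ^ n = (cnj z * z) ^ j * z ^ (n - j)"
      using assms by (simp add: power_mult_distrib flip: power_add)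
    then have "cnj z ^ j * z ^ n = z ^ (n - j)" unfolding z by simp
    then have "cnj z ^ j * poly (\<Phi> n) z / (R * cnj R) = z ^ (n - j) * cnj R / (R * cnj R)"
      unfolding P by (simp only: mult.assoc[symmetric])
    also have "\<dots> = z ^ (n - j) * (1 / R)" using R by simp
    finally show ?thesis unfolding z_def R_def complex_norm_square .
  qed
  then show ?thesis unfolding bs_moment_def using assms by (simp add: integral_cis_power_rev_Phi del: times_divide_eq_right)
qed

text \<open>One factor \<open>rev_Phi n\<close> of the denominator cancels, and what remains is the
  conjugate of a holomorphic integrand.\<close>

lemma bs_moment_top_rev_Phi: "bs_moment n j (rev_Phi n) = (if j = 0 then 1 else 0)"
proof -
  have "cnj (cis \<theta>) ^ j * poly (rev_Phi n) (cis \<theta>) / of_real ((norm (poly (rev_Phi n) (cis \<theta>)))\<^sup>2)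
      = cnj (cis \<theta> ^ j * (1 / poly (rev_Phi n) (cis \<theta>)))" for \<theta>
    unfolding complex_norm_square using rev_Phi_nonzero[of "cis \<theta>" n] by simp
  then have "bs_moment n j (rev_Phi n)
      = cnj (\<integral>\<theta>. cis \<theta> ^ j * (1 / poly (rev_Phi n) (cis \<theta>)) \<partial>angle_measure)"
    unfolding bs_moment_def by (simp only:) (rule Bochner_Integration.integral_cnj)
  then show ?thesis unfolding integral_cis_power_rev_Phi by simp
qed

lemma complex_one_minus_norm_square: "complex_of_real (1 - (norm a)\<^sup>2) = 1 - a * cnj a"
  unfolding of_real_diff complex_norm_square by simp

text \<open>The moments are known at the top index \<open>n\<close>. Inverting the Szego recursion
  carries orthogonality down to every \<open>k \<le> n\<close>; each step divides by the determinant
  1 - |\<alpha>|^2, and the product keeps track of these factors.\<close>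

lemma bs_moment_descend:
  assumes "k \<le> n"
  shows "(\<forall>j<k. bs_moment n j (\<Phi> k) = 0) \<and>
    (\<forall>j. 0 < j \<longrightarrow> j \<le> k \<longrightarrow> bs_moment n j (rev_Phi k) = 0) \<and>
    bs_moment n 0 (rev_Phi k) * (\<Prod>i\<in>{k..<n}. of_real (1 - (norm (\<alpha> i))\<^sup>2)) = 1"
  using assms
proof (induction rule: inc_induct)
  case base
  then show ?case using bs_moment_top_Phi bs_moment_top_rev_Phi by simp
next
  case (step k)
  define \<rho> where "\<rho> = complex_of_real (1 - (norm (\<alpha> k))\<^sup>2)"
  have "(norm (\<alpha> k))\<^sup>2 < 1" using norm_alpha[of k] by (simp add: abs_square_less_1)
  then have \<rho>0: "\<rho> \<noteq> 0" unfolding \<rho>_def of_real_eq_0_iff by simp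
  have \<rho>: "\<rho> = 1 - \<alpha> k * cnj (\<alpha> k)" unfolding \<rho>_def by (rule complex_one_minus_norm_square)
  \<comment> \<open>The Szego recursion solved for the polynomials of the lower index.\<close>
  have Phi: "smult \<rho> ([:0, 1:] * \<Phi> k) = \<Phi> (Suc k) + smult (cnj (\<alpha> k)) (rev_Phi (Suc k))"
    unfolding rev_Phi_Suc \<rho> by (simp add: Phi_Suc smult_diff_right smult_diff_left mult.commute)
  have R: "smult \<rho> (rev_Phi k) = rev_Phi (Suc k) + smult (\<alpha> k) (\<Phi> (Suc k))"
    unfolding rev_Phi_Suc \<rho> by (simp add: Phi_Suc smult_diff_right smult_diff_left mult.commute)
  have IH: "bs_moment n j (\<Phi> (Suc k)) = 0" if "j \<le> k" for j using step.IH that by simp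
  have IHR: "bs_moment n j (rev_Phi (Suc k)) = 0" if "0 < j" "j \<le> Suc k" for j
    using step.IH that by blast
  have mR: "\<rho> * bs_moment n j (rev_Phi k) = bs_moment n j (rev_Phi (Suc k)) + \<alpha> k * bs_moment n j (\<Phi> (Suc k))" for j
    using arg_cong[OF R, of "bs_moment n j"] by (simp only: bs_moment_add bs_moment_smult)
  \<comment> \<open>The inverse recursion yields z times \<open>\<Phi> k\<close>, hence the shift
    from \<open>j\<close> to \<open>Suc j\<close> on the right.\<close>
  have mP: "\<rho> * bs_moment n j (\<Phi> k) = bs_moment n (Suc j) (\<Phi> (Suc k))
      + cnj (\<alpha> k) * bs_moment n (Suc j) (rev_Phi (Suc k))" for j
    using arg_cong[OF Phi, of "bs_moment n (Suc j)"] by (simp only: bs_moment_add bs_moment_smult bs_moment_shift)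
  show ?case
  proof (intro conjI allI impI)
    fix j assume "j < k"
    then show "bs_moment n j (\<Phi> k) = 0" using mP[of j] IH[of "Suc j"] IHR[of "Suc j"] \<rho>0 by simp
  next
    fix j assume "0 < j" "j \<le> k"
    then show "bs_moment n j (rev_Phi k) = 0" using mR[of j] IH[of j] IHR[of j] \<rho>0 by simp
  next
    have "{k..<n} = insert k {Suc k..<n}" using step.hyps by auto
    then have "bs_moment n 0 (rev_Phi k) * (\<Prod>i\<in>{k..<n}. of_real (1 - (norm (\<alpha> i))\<^sup>2))
        = (\<rho> * bs_moment n 0 (rev_Phi k)) * (\<Prod>i\<in>{Suc k..<n}. of_real (1 - (norm (\<alpha> i))\<^sup>2))"
      by (simp add: \<rho>_def mult_ac)
    also have "\<dots> = 1" unfolding mR IH[OF le0] using step.IH by simp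
    finally show "bs_moment n 0 (rev_Phi k) * (\<Prod>i\<in>{k..<n}. of_real (1 - (norm (\<alpha> i))\<^sup>2)) = 1" .
  qed
qed

text \<open>The product in the numerator normalizes the total mass to 1, by the case
  \<open>k = 0\<close> of \<open>bs_moment_descend\<close>.\<close>

definition bs_weight :: "nat \<Rightarrow> real \<Rightarrow> real" where
  "bs_weight n \<theta> = (\<Prod>i<n. 1 - (norm (\<alpha> i))\<^sup>2) / (norm (poly (rev_Phi n) (cis \<theta>)))\<^sup>2"

lemma bs_weight_pos: "0 < bs_weight n \<theta>"
proof -
  have "0 < 1 - (norm (\<alpha> i))\<^sup>2" for i
    using norm_alpha[of i] by (simp add: abs_square_less_1)
  then show ?thesis
    unfolding bs_weight_def using rev_Phi_nonzero[of "cis \<theta>" n] by (intro divide_pos_pos prod_pos) auto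
qed

lemma continuous_on_bs_weight: "continuous_on A (bs_weight n)"
  unfolding bs_weight_def using rev_Phi_nonzero[of "cis _" n]
  by (intro continuous_intros) auto

lemma integral_bs_weight_poly:
  "(\<integral>\<theta>. bs_weight n \<theta> * poly q (cis \<theta>) \<partial>angle_measure)
     = of_real (\<Prod>i<n. 1 - (norm (\<alpha> i))\<^sup>2) * bs_moment n 0 q"
  unfolding bs_moment_def bs_weight_def by (subst integral_mult_right_zero[symmetric]) simp

lemma integral_bs_weight_Phi:
  assumes "k \<le> n"
  shows "(\<integral>\<theta>. bs_weight n \<theta> * poly (\<Phi> k) (cis \<theta>) \<partial>angle_measure) = (if k = 0 then 1 else 0)"
proof (cases "k = 0")
  case True
  then show ?thesis
    unfolding integral_bs_weight_poly using bs_moment_descend[of 0 n]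
    unfolding True by (simp add: rev_Phi_0[unfolded Phi_0] Phi_0 mult.commute lessThan_atLeast0)
next
  case False
  then show ?thesis unfolding integral_bs_weight_poly using bs_moment_descend[OF assms] by simp
qed

end

section \<open>Orthogonality on the circle\<close>

lemma space_circle:
  assumes "sets \<mu> = sets circle_borel"
  shows "space \<mu> = sphere 0 1"
  using sets_eq_imp_space_eq[OF assms] by (simp add: circle_borel_def space_restrict_space)

lemma integrable_circle:
  fixes f :: "complex \<Rightarrow> 'a :: {banach, second_countable_topology}"
  assumes fin: "finite_measure \<mu>" and sets: "sets \<mu> = sets circle_borel"
    and cont: "continuous_on (sphere 0 1) f"
  shows "integrable \<mu> f"
proof -
  interpret finite_measure \<mu> by (rule fin)
  have "bounded (f ` sphere 0 1)"
    by (rule compact_imp_bounded[OF compact_continuous_image[OF cont compact_sphere]])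
  then obtain B where "\<forall>x\<in>f ` sphere 0 1. norm x \<le> B"
    unfolding bounded_iff ..
  then have B: "\<forall>z\<in>sphere 0 1. norm (f z) \<le> B" by simp
  have "f \<in> borel_measurable (restrict_space borel (sphere 0 1))"
    by (rule borel_measurable_continuous_on_restrict[OF cont])
  then have "f \<in> borel_measurable \<mu>"
    using measurable_cong_sets[OF sets refl] unfolding circle_borel_def by blast
  then show ?thesis
    by (intro integrable_const_bound[where B = B] AE_I2) (use B space_circle[OF sets] in auto)
qed

text \<open>If the integral were zero, the polynomial would vanish almost everywhere, hence on the
  whole support, which is infinite.\<close>

lemma integral_norm_poly_pos:
  assumes fin: "finite_measure \<mu>" and sets: "sets \<mu> = sets circle_borel"
    and supp: "infinite (measure_support \<mu>)" and "p \<noteq> 0"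
  shows "0 < (\<integral>z. (norm (poly p z))\<^sup>2 \<partial>\<mu>)"
proof (rule ccontr)
  assume "\<not> ?thesis"
  moreover have "0 \<le> (\<integral>z. (norm (poly p z))\<^sup>2 \<partial>\<mu>)" by simp
  ultimately have "(\<integral>z. (norm (poly p z))\<^sup>2 \<partial>\<mu>) = 0" by simp
  moreover have "integrable \<mu> (\<lambda>z. (norm (poly p z))\<^sup>2)"
    by (intro integrable_circle[OF fin sets] continuous_intros)
  ultimately have "AE z in \<mu>. (norm (poly p z))\<^sup>2 = 0"
    by (subst (asm) integral_nonneg_eq_0_iff_AE) auto
  then have "AE z in \<mu>. \<not> poly p z \<noteq> 0" by simp
  then have null: "emeasure \<mu> {z \<in> space \<mu>. poly p z \<noteq> 0} = 0" by (rule emeasure_eq_0_AE)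
  have "finite {z. poly p z = 0}" using \<open>p \<noteq> 0\<close> by (rule poly_roots_finite)
  with supp have "\<not> measure_support \<mu> \<subseteq> {z. poly p z = 0}" using finite_subset by blast
  then obtain x where x: "x \<in> measure_support \<mu>" "poly p x \<noteq> 0" by blast
  have "open {z. poly p z \<noteq> 0}" by (intro open_Collect_neq continuous_intros)
  then have "0 < emeasure \<mu> ({z. poly p z \<noteq> 0} \<inter> space \<mu>)"
    using x unfolding measure_support_def by blast
  moreover have "{z. poly p z \<noteq> 0} \<inter> space \<mu> = {z \<in> space \<mu>. poly p z \<noteq> 0}" by blast
  ultimately show False using null by simp
qed

text \<open>Subtracting multiples of the \<Phi> of matching degree removes the coefficients from the
  top down. Linear identities then need checking only on the basis.\<close>

lemma monic_basis_induct:
  fixes \<Phi> :: "nat \<Rightarrow> 'a :: comm_ring_1 poly"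
  assumes deg: "\<And>k. degree (\<Phi> k) = k" and lead: "\<And>k. lead_coeff (\<Phi> k) = 1"
    and zero: "P 0" and add: "\<And>p c k. k \<le> n \<Longrightarrow> P p \<Longrightarrow> P (p + smult c (\<Phi> k))"
    and p: "degree p \<le> n"
  shows "P p"
proof -
  have "P q" if "m \<le> Suc n" "\<forall>i\<ge>m. coeff q i = 0" for m q
    using that
  proof (induction m arbitrary: q)
    case 0
    then have "q = 0" by (intro poly_eqI) simp
    then show ?case using zero by simp
  next
    case (Suc m)
    define r where "r = q - smult (coeff q m) (\<Phi> m)"
    have "coeff r i = 0" if "i \<ge> m" for i
    proof (cases "i = m")
      case True
      then show ?thesis using lead[of m] deg[of m] by (simp add: r_def)
    next
      case False
      then have "coeff (\<Phi> m) i = 0" using deg[of m] that by (intro coeff_eq_0) simp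
      then show ?thesis using Suc.prems(2) False that by (simp add: r_def)
    qed
    then have "P r" using Suc.IH Suc.prems(1) by simp
    then have "P (r + smult (coeff q m) (\<Phi> m))" using Suc.prems(1) by (intro add) auto
    then show ?case by (simp add: r_def)
  qed
  from this[of "Suc n" p] show ?thesis using p by (simp add: coeff_eq_0)
qed

locale circle_opuc = szego_recursion + prob_space \<mu> for \<mu> :: "complex measure" +
  assumes sets_mu: "sets \<mu> = sets circle_borel"
    and infinite_support: "infinite (measure_support \<mu>)"
    and orthogonal: "m \<noteq> n \<Longrightarrow> (\<integral>z. cnj (poly (\<Phi> m) z) * poly (\<Phi> n) z \<partial>\<mu>) = 0"
begin

lemma integrable_mu:
  fixes f :: "complex \<Rightarrow> 'z :: {banach, second_countable_topology}"
  shows "continuous_on (sphere 0 1) f \<Longrightarrow> integrable \<mu> f"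
  by (rule integrable_circle[OF finite_measure_axioms sets_mu])

lemma orthogonal_lower:
  assumes "degree p \<le> n"
  shows "(\<integral>z. cnj (poly p z) * poly (\<Phi> (Suc n)) z \<partial>\<mu>) = 0"
  using degree_Phi lead_Phi _ _ assms
proof (rule monic_basis_induct)
  fix q c k
  assume "k \<le> n" and q: "(\<integral>z. cnj (poly q z) * poly (\<Phi> (Suc n)) z \<partial>\<mu>) = 0"
  have "(\<integral>z. cnj (poly (q + smult c (\<Phi> k)) z) * poly (\<Phi> (Suc n)) z \<partial>\<mu>)
      = (\<integral>z. cnj (poly q z) * poly (\<Phi> (Suc n)) z + cnj c * (cnj (poly (\<Phi> k) z) * poly (\<Phi> (Suc n)) z) \<partial>\<mu>)"
    by (simp add: algebra_simps)
  also have "\<dots> = (\<integral>z. cnj (poly q z) * poly (\<Phi> (Suc n)) z \<partial>\<mu>)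
      + cnj c * (\<integral>z. cnj (poly (\<Phi> k) z) * poly (\<Phi> (Suc n)) z \<partial>\<mu>)"
    by (subst Bochner_Integration.integral_add) (auto intro!: integrable_mu continuous_intros)
  also have "\<dots> = 0" using q orthogonal[of k "Suc n"] \<open>k \<le> n\<close> by simp
  finally show "(\<integral>z. cnj (poly (q + smult c (\<Phi> k)) z) * poly (\<Phi> (Suc n)) z \<partial>\<mu>) = 0" .
qed simp

text \<open>In z \<Phi>(n) = \<Phi>(n+1) + cnj \<alpha>(n) times the reversal of \<Phi>(n), the two
  terms on the right are orthogonal because the reversal has degree at most n. Pythagoras gives (1 -
  |\<alpha>|^2) N(n) = N(n+1), and both norms are positive since the support is infinite.\<close>

lemma norm_Verblunsky: "norm (\<alpha> n) < 1"
proof -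
  define N where "N k = (\<integral>z. (norm (poly (\<Phi> k) z))\<^sup>2 \<partial>\<mu>)" for k
  have N_pos: "0 < N k" for k
  proof -
    have "\<Phi> k \<noteq> 0" using lead_Phi[of k] by auto
    then show ?thesis unfolding N_def
      by (rule integral_norm_poly_pos[OF finite_measure_axioms sets_mu infinite_support])
  qed
  have deg: "degree (rev_Phi n) \<le> n"
    unfolding reversed_poly_def using degree_reflect_poly_le[of "map_poly cnj (\<Phi> n)"] degree_Phi[of n]
    by (simp add: degree_map_poly)
  have "norm (poly (\<Phi> n) z) ^ 2 = norm (poly (\<Phi> (Suc n)) z) ^ 2
      + (norm (\<alpha> n))\<^sup>2 * norm (poly (\<Phi> n) z) ^ 2
      + 2 * Re (\<alpha> n * (cnj (poly (rev_Phi n) z) * poly (\<Phi> (Suc n)) z))" if "z \<in> space \<mu>" for z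
  proof -
    have z: "norm z = 1" using that space_circle[OF sets_mu] by simp
    define p q where "p = poly (\<Phi> (Suc n)) z" and "q = cnj (\<alpha> n) * poly (rev_Phi n) z"
    have "z * poly (\<Phi> n) z = p + q" by (simp add: p_def q_def Phi_Suc)
    then have "norm (poly (\<Phi> n) z) = norm (p + q)" using z by (metis mult_1 norm_mult)
    moreover have "norm (p + q) ^ 2 = norm p ^ 2 + norm q ^ 2 + 2 * Re (cnj q * p)"
      unfolding cmod_power2 by (simp add: power2_eq_square algebra_simps)
    moreover have "norm q ^ 2 = (norm (\<alpha> n))\<^sup>2 * norm (poly (\<Phi> n) z) ^ 2"
      unfolding q_def by (simp add: norm_mult power_mult_distrib norm_rev_Phi_circle[OF z])
    moreover have "cnj q * p = \<alpha> n * (cnj (poly (rev_Phi n) z) * p)" by (simp add: q_def)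
    ultimately show ?thesis unfolding p_def by simp
  qed
  then have "N n = (\<integral>z. norm (poly (\<Phi> (Suc n)) z) ^ 2
      + (norm (\<alpha> n))\<^sup>2 * norm (poly (\<Phi> n) z) ^ 2
      + 2 * Re (\<alpha> n * (cnj (poly (rev_Phi n) z) * poly (\<Phi> (Suc n)) z)) \<partial>\<mu>)"
    unfolding N_def by (intro Bochner_Integration.integral_cong refl) blast
  also have "\<dots> = N (Suc n) + (norm (\<alpha> n))\<^sup>2 * N n
      + 2 * Re (\<alpha> n * (\<integral>z. cnj (poly (rev_Phi n) z) * poly (\<Phi> (Suc n)) z \<partial>\<mu>))"
  proof -
    have i1: "integrable \<mu> (\<lambda>z. norm (poly (\<Phi> k) z) ^ 2)" for k
      by (intro integrable_mu continuous_intros)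
    have i2: "integrable \<mu> (\<lambda>z. cnj (poly (rev_Phi n) z) * poly (\<Phi> (Suc n)) z)"
      by (intro integrable_mu continuous_intros)
    then have i3: "integrable \<mu> (\<lambda>z. \<alpha> n * (cnj (poly (rev_Phi n) z) * poly (\<Phi> (Suc n)) z))"
      by (rule integrable_mult_right)
    show ?thesis
      unfolding N_def
      by (simp only: Bochner_Integration.integral_add Bochner_Integration.integrable_add
          integrable_mult_right i1 i3 integrable_Re integral_mult_right_zero integral_Re)
  qed
  also have "\<dots> = N (Suc n) + (norm (\<alpha> n))\<^sup>2 * N n"
    unfolding orthogonal_lower[OF deg] by simp
  finally have "(norm (\<alpha> n))\<^sup>2 * N n < 1 * N n" using N_pos[of "Suc n"] by simp
  then have "(norm (\<alpha> n))\<^sup>2 < 1" using N_pos[of n] by (simp only: mult_less_cancel_right_pos)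
  then show ?thesis by (simp add: abs_square_less_1)
qed

sublocale contractive_szego_recursion
  by unfold_locales (rule norm_Verblunsky)

text \<open>Both functionals take the value 1 at \<open>\<Phi> 0 = 1\<close> and vanish at
  \<open>\<Phi> k\<close> for \<open>0 < k \<le> n\<close>; these polynomials span all degrees up to
  \<open>n\<close>.\<close>

lemma integral_poly_eq_bs_weight:
  assumes "degree p \<le> n"
  shows "(\<integral>z. poly p z \<partial>\<mu>) = (\<integral>\<theta>. bs_weight n \<theta> * poly p (cis \<theta>) \<partial>angle_measure)"
  using degree_Phi lead_Phi _ _ assms
proof (rule monic_basis_induct)
  fix q c k
  assume k: "k \<le> n" and IH: "(\<integral>z. poly q z \<partial>\<mu>) = (\<integral>\<theta>. bs_weight n \<theta> * poly q (cis \<theta>) \<partial>angle_measure)"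
  have "(\<integral>z. poly (q + smult c (\<Phi> k)) z \<partial>\<mu>) = (\<integral>z. poly q z \<partial>\<mu>) + c * (\<integral>z. poly (\<Phi> k) z \<partial>\<mu>)"
    by (simp, subst Bochner_Integration.integral_add) (auto intro!: integrable_mu continuous_intros)
  moreover have "(\<integral>z. poly (\<Phi> k) z \<partial>\<mu>) = (if k = 0 then 1 else 0)"
    using orthogonal[of 0 k] by (simp add: Phi_0 prob_space)
  moreover have "(\<integral>\<theta>. bs_weight n \<theta> * poly (q + smult c (\<Phi> k)) (cis \<theta>) \<partial>angle_measure)
      = (\<integral>\<theta>. bs_weight n \<theta> * poly q (cis \<theta>) + c * (bs_weight n \<theta> * poly (\<Phi> k) (cis \<theta>)) \<partial>angle_measure)"
    by (simp add: algebra_simps)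
  moreover have "\<dots> = (\<integral>\<theta>. bs_weight n \<theta> * poly q (cis \<theta>) \<partial>angle_measure)
      + c * (\<integral>\<theta>. bs_weight n \<theta> * poly (\<Phi> k) (cis \<theta>) \<partial>angle_measure)"
    by (subst Bochner_Integration.integral_add)
      (auto intro!: integrable_angle_measure continuous_intros continuous_on_bs_weight)
  ultimately show "(\<integral>z. poly (q + smult c (\<Phi> k)) z \<partial>\<mu>)
      = (\<integral>\<theta>. bs_weight n \<theta> * poly (q + smult c (\<Phi> k)) (cis \<theta>) \<partial>angle_measure)"
    using IH integral_bs_weight_Phi[OF k] by simp
qed simp

end

section \<open>The entropy inequality\<close>

text \<open>In a real trigonometric polynomial the negative frequencies are conjugate to the
  positive ones, so it is the real part of an ordinary polynomial. Moments of ordinary polynomials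
  then suffice.\<close>

definition trig_poly :: "(complex \<Rightarrow> real) \<Rightarrow> bool" where
  "trig_poly f \<longleftrightarrow> (\<exists>p. \<forall>z. norm z = 1 \<longrightarrow> f z = Re (poly p z))"

lemma trig_polyI: "(\<And>z. norm z = 1 \<Longrightarrow> f z = Re (poly p z)) \<Longrightarrow> trig_poly f"
  unfolding trig_poly_def by blast

lemma trig_poly_add: "trig_poly f \<Longrightarrow> trig_poly g \<Longrightarrow> trig_poly (\<lambda>z. f z + g z)"
  unfolding trig_poly_def by (metis plus_complex.sel(1) poly_add)

lemma trig_poly_const: "trig_poly (\<lambda>z. c)"
  by (rule trig_polyI[of _ "[:of_real c:]"]) simp

text \<open>The lowest coefficient contributes a pure negative power, whose real part is unchanged
  by conjugation; in the remaining terms one factor z cancels one factor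
  \<open>cnj z\<close>.\<close>

lemma trig_poly_Laurent: "trig_poly (\<lambda>z. Re (poly r z * cnj z ^ m))"
proof (induction m arbitrary: r)
  case 0
  show ?case by (rule trig_polyI[of _ r]) simp
next
  case (Suc m)
  obtain c s where r: "r = pCons c s" by (cases r)
  have "trig_poly (\<lambda>z. Re (c * cnj z ^ Suc m))"
  proof (rule trig_polyI)
    fix z :: complex
    have "Re (c * cnj z ^ Suc m) = Re (cnj (c * cnj z ^ Suc m))" by (rule cnj.simps(1)[symmetric])
    also have "\<dots> = Re (poly (monom (cnj c) (Suc m)) z)" by (simp add: poly_monom)
    finally show "Re (c * cnj z ^ Suc m) = Re (poly (monom (cnj c) (Suc m)) z)" .
  qed
  then have "trig_poly (\<lambda>z. Re (c * cnj z ^ Suc m) + Re (poly s z * cnj z ^ m))"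
    using Suc.IH by (rule trig_poly_add)
  then obtain p where p: "\<And>z. norm z = 1 \<Longrightarrow>
      Re (c * cnj z ^ Suc m) + Re (poly s z * cnj z ^ m) = Re (poly p z)"
    unfolding trig_poly_def by blast
  show ?case
  proof (rule trig_polyI)
    fix z :: complex assume z: "norm z = 1"
    have "poly r z * cnj z ^ Suc m = c * cnj z ^ Suc m + (z * cnj z) * (poly s z * cnj z ^ m)"
      by (simp add: r algebra_simps)
    also have "z * cnj z = 1" using z by (simp add: complex_norm_square[symmetric])
    finally show "Re (poly r z * cnj z ^ Suc m) = Re (poly p z)" using p[OF z] by simp
  qed
qed

lemma trig_poly_mult_cnj: "trig_poly (\<lambda>z. Re (poly p z * cnj z ^ m * cnj (poly q z)))"
proof (induction q arbitrary: m)
  case 0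
  then show ?case using trig_poly_const[of 0] by simp
next
  case (pCons a q)
  have "trig_poly (\<lambda>z. Re (poly (smult (cnj a) p) z * cnj z ^ m)
      + Re (poly p z * cnj z ^ Suc m * cnj (poly q z)))"
    by (rule trig_poly_add[OF trig_poly_Laurent pCons.IH])
  moreover have eq: "Re (poly (smult (cnj a) p) z * cnj z ^ m)
      + Re (poly p z * cnj z ^ Suc m * cnj (poly q z))
      = Re (poly p z * cnj z ^ m * cnj (poly (pCons a q) z))" for z
    by (simp only: plus_complex.sel(1)[symmetric]) (simp add: algebra_simps)
  ultimately show ?case by (simp only: eq)
qed

text \<open>Re p Re q is the real part of (p q + p cnj q) / 2, and \<open>trig_poly_mult_cnj\<close>
  treats the second product.\<close>

lemma trig_poly_mult:
  assumes "trig_poly f" "trig_poly g"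
  shows "trig_poly (\<lambda>z. f z * g z)"
proof -
  obtain p q where pq: "\<And>z. norm z = 1 \<Longrightarrow> f z = Re (poly p z)" "\<And>z. norm z = 1 \<Longrightarrow> g z = Re (poly q z)"
    using assms unfolding trig_poly_def by blast
  have "trig_poly (\<lambda>z. Re (poly (smult (1 / 2) (p * q)) z)
      + Re (poly (smult (1 / 2) p) z * cnj z ^ 0 * cnj (poly q z)))"
    by (intro trig_poly_add trig_poly_mult_cnj trig_polyI) (rule refl)
  then obtain r where r: "\<And>z. norm z = 1 \<Longrightarrow> Re (poly (smult (1 / 2) (p * q)) z)
      + Re (poly (smult (1 / 2) p) z * cnj z ^ 0 * cnj (poly q z)) = Re (poly r z)"
    unfolding trig_poly_def by blast
  show ?thesis
    by (rule trig_polyI[of _ r]) (simp add: pq r[symmetric] diff_divide_distrib add_divide_distrib)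
qed

lemma trig_poly_continuous:
  assumes "trig_poly f"
  shows "continuous_on (sphere 0 1) f"
proof -
  obtain p where p: "\<And>z. norm z = 1 \<Longrightarrow> f z = Re (poly p z)"
    using assms unfolding trig_poly_def by blast
  have "continuous_on (sphere 0 1) (\<lambda>z. Re (poly p z))" by (intro continuous_intros)
  then show ?thesis by (rule continuous_on_eq) (simp add: p)
qed

text \<open>Stone--Weierstrass: the real and imaginary parts of z are trigonometric polynomials and
  separate points.\<close>

lemma trig_poly_approx:
  assumes "continuous_on (sphere 0 1) f" "0 < e"
  obtains g where "trig_poly g" "\<And>z. norm z = 1 \<Longrightarrow> \<bar>f z - g z\<bar> < e"
proof -
  have "\<exists>g. trig_poly g \<and> (\<forall>z\<in>sphere 0 1. \<bar>f z - g z\<bar> < e)"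
  proof (rule Stone_Weierstrass_HOL[where P = trig_poly])
    fix x y :: complex assume xy: "x \<in> sphere 0 1 \<and> y \<in> sphere 0 1 \<and> x \<noteq> y"
    have "trig_poly Re" by (rule trig_polyI[of _ "[:0, 1:]"]) simp
    moreover have "trig_poly Im" by (rule trig_polyI[of _ "[:0, - \<i>:]"]) simp
    ultimately show "\<exists>f. trig_poly f \<and> f x \<noteq> f y" using xy complex_eq_iff by blast
  qed (use assms trig_poly_const trig_poly_continuous trig_poly_add trig_poly_mult in auto)
  then show ?thesis using that by auto
qed

section \<open>The entropy of the Bernstein--Szego weights\<close>

lemma integral_szego_weight: "(\<integral>\<theta>. szego_weight \<theta> \<partial>angle_measure) = 1 / 2"
proof -
  have "complex_of_real (\<integral>\<theta>. szego_weight \<theta> \<partial>angle_measure)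
      = (\<integral>\<theta>. szego_weight \<theta> * (\<lambda>z. 1 :: complex) (cis \<theta>) \<partial>angle_measure)"
    by (simp add: integral_of_real)
  also have "\<dots> = 1 / 2"
    using integral_szego_weight_holomorphic[of "\<lambda>z. 1" UNIV]
    by (simp add: numeral_2_eq_2 numeral_3_eq_3)
  finally show ?thesis by (metis of_real_1 of_real_divide of_real_eq_iff of_real_numeral)
qed

context contractive_szego_recursion
begin

lemma integral_szego_weight_ln_bs_weight:
  "(\<integral>\<theta>. szego_weight \<theta> * ln (bs_weight n \<theta>) \<partial>angle_measure)
     = (\<Sum>i<n. ln (1 - (norm (\<alpha> i))\<^sup>2)) / 2 - Re (log_moment n)"
proof -
  define c where "c = (\<Prod>i<n. 1 - (norm (\<alpha> i))\<^sup>2)"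
  define R where "R \<theta> = norm (poly (rev_Phi n) (cis \<theta>))" for \<theta>
  have pos: "0 < 1 - (norm (\<alpha> i))\<^sup>2" for i
    using norm_alpha[of i] by (simp add: abs_square_less_1)
  then have c: "0 < c" unfolding c_def by (auto intro: prod_pos)
  have ln_c: "ln c = (\<Sum>i<n. ln (1 - (norm (\<alpha> i))\<^sup>2))"
    unfolding c_def by (rule ln_prod[OF finite_lessThan less_imp_neq[OF pos, symmetric]])
  have R: "0 < R \<theta>" for \<theta> unfolding R_def using rev_Phi_nonzero[of "cis \<theta>" n] by simp
  have ln_bs: "szego_weight \<theta> * ln (bs_weight n \<theta>)
      = ln c * szego_weight \<theta> - 2 * (szego_weight \<theta> * ln (R \<theta>))" for \<theta>
    using c R[of \<theta>] unfolding bs_weight_def c_def[symmetric] R_def[symmetric]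
    by (simp add: ln_div ln_realpow algebra_simps)
  have i1: "integrable angle_measure szego_weight"
    by (intro integrable_angle_measure continuous_intros)
  have "continuous_on UNIV (\<lambda>\<theta>. szego_weight \<theta> * ln (R \<theta>))"
    unfolding R_def using rev_Phi_nonzero[of "cis _" n] by (intro continuous_intros) auto
  then have i2: "integrable angle_measure (\<lambda>\<theta>. szego_weight \<theta> * ln (R \<theta>))"
    by (rule integrable_angle_measure)
  have "(\<integral>\<theta>. szego_weight \<theta> * ln (R \<theta>) \<partial>angle_measure) = Re (log_moment n) / 2"
    unfolding R_def log_moment_def Let_def
    by (rule integral_szego_weight_ln_poly) (auto simp: rev_Phi_nonzero rev_Phi_at_0)
  then show ?thesis
    unfolding ln_bs using i1 i2 ln_c by (simp add: integral_szego_weight)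
qed

text \<open>Summing the increments from index 3 on gives the sum already bounded; the first three
  logarithms and \<open>log_moment 3\<close> go into the constant.\<close>

lemma entropy_bounded_below:
  assumes real: "\<And>k. \<alpha> k = complex_of_real (a k)"
    and s2: "summable (\<lambda>n. (a (n + 3) - a (n + 2) - a (n + 1) + a n)\<^sup>2)"
    and s4: "summable (\<lambda>n. (a (n + 2) - 2 * a (n + 1) + a n) ^ 4)"
    and s6: "summable (\<lambda>n. a n ^ 6)"
  obtains C where "\<And>N. - (\<integral>\<theta>. szego_weight \<theta> * ln (bs_weight (N + 3) \<theta>) \<partial>angle_measure) \<le> C"
proof -
  have norm_a: "norm (\<alpha> k) = \<bar>a k\<bar>" for k by (simp add: real)
  have a1: "\<bar>a k\<bar> < 1" for k using norm_alpha[of k] unfolding norm_a .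
  obtain C where C: "\<And>N. (\<Sum>n<N. - ln (1 - (a (n + 3))\<^sup>2) / 2
      + szego_increment (a (n + 3)) (a (n + 2)) (a (n + 1)) (a n)) \<le> C"
    using szego_increment_sum_bounded[OF a1 s2 s4 s6] by blast
  have lm: "Re (log_moment (N + 3)) = Re (log_moment 3)
      + (\<Sum>n<N. szego_increment (a (n + 3)) (a (n + 2)) (a (n + 1)) (a n))" for N
  proof (induction N)
    case (Suc N)
    have "Suc N + 3 = N + 4" by simp
    then show ?case using Suc by (simp only: log_moment_Suc[OF real] plus_complex.sel) simp
  qed simp
  show ?thesis
  proof (rule that)
    fix N
    have "(\<Sum>i<N + 3. ln (1 - (a i)\<^sup>2)) = (\<Sum>i<3. ln (1 - (a i)\<^sup>2)) + (\<Sum>n<N. ln (1 - (a (n + 3))\<^sup>2))"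
      by (induction N) (simp_all only: add_Suc sum.lessThan_Suc add_0 lessThan_0 sum.empty add_0_right add.assoc)
    then have "- (\<integral>\<theta>. szego_weight \<theta> * ln (bs_weight (N + 3) \<theta>) \<partial>angle_measure)
        = Re (log_moment 3) - (\<Sum>i<3. ln (1 - (a i)\<^sup>2)) / 2
          + (\<Sum>n<N. - ln (1 - (a (n + 3))\<^sup>2) / 2
            + szego_increment (a (n + 3)) (a (n + 2)) (a (n + 1)) (a n))"
      unfolding integral_szego_weight_ln_bs_weight lm norm_a power2_abs
      by (simp add: sum.distrib sum_subtractf sum_negf sum_divide_distrib[symmetric] add_divide_distrib)
    then show "- (\<integral>\<theta>. szego_weight \<theta> * ln (bs_weight (N + 3) \<theta>) \<partial>angle_measure)
        \<le> Re (log_moment 3) - (\<Sum>i<3. ln (1 - (a i)\<^sup>2)) / 2 + C"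
      using C[of N] by linarith
  qed
qed

end

lemma continuous_on_circle_cis:
  "continuous_on (sphere 0 1) f \<Longrightarrow> continuous_on UNIV (\<lambda>\<theta>. f (cis \<theta>))"
  by (rule continuous_on_compose2[of "sphere 0 1" f]) (auto intro: continuous_intros)

section \<open>Transfer of the entropy bound to the measure\<close>

context circle_opuc
begin

text \<open>For large \<open>n\<close> the integral of \<open>f\<close> is the same against \<mu>
  and \<open>bs_weight n\<close>. Integrating ln (f w) \<le> f w with the weight, which is at most
  2, then isolates the integral of ln f.\<close>

lemma entropy_inequality_trig_poly:
  assumes C: "\<And>N. - (\<integral>\<theta>. szego_weight \<theta> * ln (bs_weight (N + 3) \<theta>) \<partial>angle_measure) \<le> C"
    and f: "trig_poly f" and pos: "\<And>z. norm z = 1 \<Longrightarrow> 0 < f z"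
  shows "(\<integral>\<theta>. szego_weight \<theta> * ln (f (cis \<theta>)) \<partial>angle_measure) \<le> 2 * (\<integral>z. f z \<partial>\<mu>) + C"
proof -
  obtain p where p: "\<And>z. norm z = 1 \<Longrightarrow> f z = Re (poly p z)"
    using f unfolding trig_poly_def by blast
  \<comment> \<open>At least the degree of \<open>p\<close>, so that the moments agree, and of the
    form \<open>N + 3\<close> required by \<open>C\<close>.\<close>
  define n where "n = degree p + 3"
  have contf: "continuous_on UNIV (\<lambda>\<theta>. f (cis \<theta>))"
    by (rule continuous_on_circle_cis[OF trig_poly_continuous[OF f]])
  have posc: "0 < f (cis \<theta>)" for \<theta> by (rule pos) simp
  have "(\<integral>z. f z \<partial>\<mu>) = (\<integral>z. Re (poly p z) \<partial>\<mu>)"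
    using space_circle[OF sets_mu] by (intro Bochner_Integration.integral_cong) (auto simp: p)
  also have "\<dots> = Re (\<integral>z. poly p z \<partial>\<mu>)"
    by (intro integral_Re integrable_mu continuous_intros)
  also have "(\<integral>z. poly p z \<partial>\<mu>) = (\<integral>\<theta>. bs_weight n \<theta> * poly p (cis \<theta>) \<partial>angle_measure)"
    by (rule integral_poly_eq_bs_weight) (simp add: n_def)
  also have "Re \<dots> = (\<integral>\<theta>. Re (bs_weight n \<theta> * poly p (cis \<theta>)) \<partial>angle_measure)"
    by (intro integral_Re[symmetric] integrable_angle_measure continuous_intros continuous_on_bs_weight)
  also have "\<dots> = (\<integral>\<theta>. bs_weight n \<theta> * f (cis \<theta>) \<partial>angle_measure)"
    by (simp add: p)
  finally have mu: "(\<integral>z. f z \<partial>\<mu>) = (\<integral>\<theta>. bs_weight n \<theta> * f (cis \<theta>) \<partial>angle_measure)" .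
  have pw: "szego_weight \<theta> * ln (bs_weight n \<theta>) + szego_weight \<theta> * ln (f (cis \<theta>))
      \<le> 2 * (bs_weight n \<theta> * f (cis \<theta>))" for \<theta>
  proof -
    have b: "0 < bs_weight n \<theta> * f (cis \<theta>)" using bs_weight_pos posc by simp
    have "szego_weight \<theta> * ln (bs_weight n \<theta>) + szego_weight \<theta> * ln (f (cis \<theta>))
        = szego_weight \<theta> * ln (bs_weight n \<theta> * f (cis \<theta>))"
      using less_imp_neq[OF bs_weight_pos[of n \<theta>], symmetric] less_imp_neq[OF posc[of \<theta>], symmetric]
      by (simp add: ln_mult algebra_simps)
    also have "\<dots> \<le> szego_weight \<theta> * (bs_weight n \<theta> * f (cis \<theta>))"
      using ln_le_minus_one[OF b] by (intro mult_left_mono szego_weight_nonneg) linarith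
    also have "\<dots> \<le> 2 * (bs_weight n \<theta> * f (cis \<theta>))"
      using b by (intro mult_right_mono szego_weight_le_2) simp
    finally show ?thesis .
  qed
  have cont1: "continuous_on UNIV (\<lambda>\<theta>. szego_weight \<theta> * ln (bs_weight n \<theta>))"
    using bs_weight_pos[of n] by (intro continuous_intros continuous_on_bs_weight) (auto simp: less_le)
  have cont2: "continuous_on UNIV (\<lambda>\<theta>. szego_weight \<theta> * ln (f (cis \<theta>)))"
    using posc by (intro continuous_intros contf) (auto simp: less_le)
  have cont3: "continuous_on UNIV (\<lambda>\<theta>. bs_weight n \<theta> * f (cis \<theta>))"
    by (intro continuous_intros contf continuous_on_bs_weight)
  note ints = integrable_angle_measure[OF cont1] integrable_angle_measure[OF cont2]
    integrable_angle_measure[OF cont3]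
  have "(\<integral>\<theta>. szego_weight \<theta> * ln (bs_weight n \<theta>) \<partial>angle_measure)
      + (\<integral>\<theta>. szego_weight \<theta> * ln (f (cis \<theta>)) \<partial>angle_measure)
      = (\<integral>\<theta>. szego_weight \<theta> * ln (bs_weight n \<theta>) + szego_weight \<theta> * ln (f (cis \<theta>)) \<partial>angle_measure)"
    by (rule Bochner_Integration.integral_add[symmetric, OF ints(1,2)])
  also have "\<dots> \<le> (\<integral>\<theta>. 2 * (bs_weight n \<theta> * f (cis \<theta>)) \<partial>angle_measure)"
    by (rule integral_mono[OF Bochner_Integration.integrable_add[OF ints(1,2)] integrable_mult_right[OF ints(3)] pw])
  also have "\<dots> = 2 * (\<integral>z. f z \<partial>\<mu>)" unfolding mu by simp
  finally show ?thesis using C[of "degree p"] unfolding n_def by linarith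
qed

lemma entropy_inequality_continuous:
  assumes C: "\<And>N. - (\<integral>\<theta>. szego_weight \<theta> * ln (bs_weight (N + 3) \<theta>) \<partial>angle_measure) \<le> C"
    and f: "continuous_on (sphere 0 1) f" and ge: "\<And>z. norm z = 1 \<Longrightarrow> 1 \<le> f z"
  shows "(\<integral>\<theta>. szego_weight \<theta> * ln (f (cis \<theta>)) \<partial>angle_measure) \<le> 2 * (\<integral>z. f z \<partial>\<mu>) + (C + 1)"
proof -
  obtain g where g: "trig_poly g" "\<And>z. norm z = 1 \<Longrightarrow> \<bar>f z - g z\<bar> < 1 / 4"
    using trig_poly_approx[OF f, of "1 / 4"] by auto
  \<comment> \<open>The shift puts the approximation above \<open>f\<close>, so that the logarithms
    compare in the right direction. It costs at most 1/2 in the integral, and 2 * (1/2) is the 1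
    added to \<open>C\<close>.\<close>
  define h where "h z = g z + 1 / 4" for z
  have h: "trig_poly h" unfolding h_def by (intro trig_poly_add g trig_poly_const)
  have fh: "f z \<le> h z" "h z \<le> f z + 1 / 2" if "norm z = 1" for z
    using g(2)[OF that] unfolding h_def by linarith+
  have pos: "0 < f z" "0 < h z" if "norm z = 1" for z
    using ge[OF that] fh[OF that] by linarith+
  have conth: "continuous_on (sphere 0 1) h" by (rule trig_poly_continuous[OF h])
  have "(\<integral>\<theta>. szego_weight \<theta> * ln (f (cis \<theta>)) \<partial>angle_measure)
      \<le> (\<integral>\<theta>. szego_weight \<theta> * ln (h (cis \<theta>)) \<partial>angle_measure)"
  proof (rule integral_mono)
    show "integrable angle_measure (\<lambda>\<theta>. szego_weight \<theta> * ln (f (cis \<theta>)))"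
      using pos by (intro integrable_angle_measure continuous_intros continuous_on_circle_cis f) (auto simp: less_le)
    show "integrable angle_measure (\<lambda>\<theta>. szego_weight \<theta> * ln (h (cis \<theta>)))"
      using pos by (intro integrable_angle_measure continuous_intros continuous_on_circle_cis conth) (auto simp: less_le)
    show "szego_weight \<theta> * ln (f (cis \<theta>)) \<le> szego_weight \<theta> * ln (h (cis \<theta>))" for \<theta>
      using pos fh by (intro mult_left_mono szego_weight_nonneg ln_mono) auto
  qed
  also have "\<dots> \<le> 2 * (\<integral>z. h z \<partial>\<mu>) + C"
    by (rule entropy_inequality_trig_poly[OF C h pos(2)])
  also have "(\<integral>z. h z \<partial>\<mu>) \<le> (\<integral>z. f z + 1 / 2 \<partial>\<mu>)"
    using space_circle[OF sets_mu]
    by (intro integral_mono integrable_mu conth continuous_intros f) (auto intro: fh)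
  also have "\<dots> = (\<integral>z. f z \<partial>\<mu>) + 1 / 2"
    by (subst Bochner_Integration.integral_add) (auto intro: integrable_mu f simp: prob_space)
  finally show ?thesis by simp
qed

end

section \<open>Extension to step functions\<close>

lemma finite_measure_outer_open:
  fixes M :: "'a :: {second_countable_topology, complete_space} measure"
  assumes "finite_measure M" and sets: "sets M = sets borel" and B: "B \<in> sets borel" and e: "0 < e"
  obtains U where "open U" "B \<subseteq> U" "measure M (U - B) \<le> e"
proof -
  interpret finite_measure M by fact
  have "emeasure M B < emeasure M B + ennreal e"
    using e emeasure_finite[of B] by (simp add: ennreal_add_left_cancel_less[of _ 0, simplified])
  then have "(INF U \<in> {U. B \<subseteq> U \<and> open U}. emeasure M U) < emeasure M B + ennreal e"
    using outer_regular[OF sets _ B] emeasure_finite[of "space M"] by simp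
  then obtain U where U: "B \<subseteq> U" "open U" "emeasure M U < emeasure M B + ennreal e"
    unfolding INF_less_iff by blast
  have sU: "U \<in> sets M" "B \<in> sets M" using U B sets by auto
  have "ennreal (measure M U) < ennreal (measure M B + e)"
    using U(3) e by (simp add: emeasure_eq_measure)
  then have "measure M U < measure M B + e" by (simp add: ennreal_less_iff)
  moreover have "measure M (U - B) = measure M U - measure M B"
    using sU U(1) by (rule finite_measure_Diff)
  ultimately show ?thesis using that[OF U(2,1)] by simp
qed

lemma cis_measurable [measurable]: "cis \<in> borel_measurable borel"
  by (intro borel_measurable_continuous_onI continuous_intros)

text \<open>Regularity is needed for two measures at once: an open \<open>U\<close> containing
  \<open>B\<close> controls the excess for \<mu>, a closed \<open>K\<close> inside \<open>B\<close>
  controls the deficit for the arc measure, and Urysohn's lemma interpolates between them.\<close>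

lemma borel_set_approx:
  fixes \<mu> :: "complex measure"
  assumes fin: "finite_measure \<mu>" and sets: "sets \<mu> = sets circle_borel"
    and B: "B \<in> sets borel" and e: "0 < e"
  obtains f K where "continuous_on UNIV f" "\<And>z. 0 \<le> f z" "\<And>z. z \<in> K \<Longrightarrow> f z = 1" "K \<in> sets borel"
    "(\<integral>z. f z \<partial>\<mu>) \<le> (\<integral>z. indicat_real B z \<partial>\<mu>) + e"
    "(\<integral>\<theta>. indicat_real (B - K) (cis \<theta>) \<partial>angle_measure) \<le> e"
proof -
  have [measurable]: "(\<lambda>z. z) \<in> \<mu> \<rightarrow>\<^sub>M borel"
    using measurable_restrict_space1[OF measurable_ident, of borel "sphere 0 (1::real) :: complex set"]
      measurable_cong_sets[OF sets refl] unfolding circle_borel_def id_def by blast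
  interpret mu: finite_measure \<mu> by (rule fin)
  interpret angle: prob_space angle_measure by (rule prob_space_angle_measure)
  \<comment> \<open>The measure is pushed to the whole plane, where outer regularity is
    available.\<close>
  have "finite_measure (distr \<mu> borel (\<lambda>z. z))" by (rule mu.finite_measure_distr) measurable
  from finite_measure_outer_open[OF this _ B e]
  obtain U where U: "open U" "B \<subseteq> U" "measure (distr \<mu> borel (\<lambda>z. z)) (U - B) \<le> e" by auto
  have "finite_measure (distr angle_measure borel cis)" by (rule angle.finite_measure_distr) measurable
  \<comment> \<open>Inner approximation of \<open>B\<close> by a closed set is outer approximation
    of its complement.\<close>
  from finite_measure_outer_open[OF this _ _ e, of "- B"]
  obtain V where V: "open V" "- B \<subseteq> V" "measure (distr angle_measure borel cis) (V - (- B)) \<le> e"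
    using B by auto
  define K where "K = - V"
  have K: "closed K" "K \<subseteq> B" using V by (auto simp: K_def closed_def)
  have [measurable]: "U \<in> sets borel" "K \<in> sets borel" "B \<in> sets borel" using U K B by auto
  have closed_U: "closed (- U)" using U(1) by (simp add: closed_def)
  have disj: "- U \<inter> K = {}" using U(2) K(2) by blast
  obtain f :: "complex \<Rightarrow> real" where f: "continuous_on UNIV f" "\<And>z. f z \<in> closed_segment 0 1"
    "\<And>z. z \<in> - U \<Longrightarrow> f z = 0" "\<And>z. z \<in> K \<Longrightarrow> f z = 1"
    by (rule Urysohn[OF closed_U K(1) disj, of 0 1], rule that)
  have f01: "0 \<le> f z" "f z \<le> 1" for z using f(2)[of z] by (auto simp: closed_segment_eq_real_ivl)
  have sub: "f z \<le> indicat_real B z + indicat_real (U - B) z" for z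
    using f01[of z] f(3)[of z] by (auto simp: indicator_def)
  have int_ind: "integrable \<mu> (\<lambda>z. indicat_real S z)" if [measurable]: "S \<in> sets borel" for S
    by (rule mu.integrable_const_bound[where B = 1]) auto
  have "(\<integral>z. f z \<partial>\<mu>) \<le> (\<integral>z. indicat_real B z + indicat_real (U - B) z \<partial>\<mu>)"
    by (intro integral_mono integrable_circle[OF fin sets] continuous_on_subset[OF f(1)]
        Bochner_Integration.integrable_add int_ind sub) auto
  also have "\<dots> = (\<integral>z. indicat_real B z \<partial>\<mu>) + (\<integral>z. indicat_real (U - B) z \<partial>\<mu>)"
    by (intro Bochner_Integration.integral_add int_ind) auto
  also have "(\<integral>z. indicat_real (U - B) z \<partial>\<mu>) = (\<integral>z. indicat_real (U - B) z \<partial>distr \<mu> borel (\<lambda>z. z))"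
    by (subst integral_distr) auto
  also have "\<dots> \<le> e" using U(3) by simp
  finally have 1: "(\<integral>z. f z \<partial>\<mu>) \<le> (\<integral>z. indicat_real B z \<partial>\<mu>) + e" by simp
  have "V - (- B) = B - K" by (auto simp: K_def)
  have "(\<integral>\<theta>. indicat_real (B - K) (cis \<theta>) \<partial>angle_measure)
      = (\<integral>z. indicat_real (B - K) z \<partial>distr angle_measure borel cis)"
    by (subst integral_distr) auto
  also have "\<dots> \<le> e" using V(3) unfolding \<open>V - (- B) = B - K\<close> by simp
  finally have 2: "(\<integral>\<theta>. indicat_real (B - K) (cis \<theta>) \<partial>angle_measure) \<le> e" .
  show ?thesis by (rule that[OF f(1) f01(1) f(4) _ 1 2]) auto
qed

text \<open>Each indicator is replaced by a continuous function. Since \<open>F\<close> is at least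
  1, ln g - ln F \<le> g - F \<le> D, so the left side changes by at most \<open>2 * T * e\<close>;
  the integral against \<mu> changes by at most \<open>T * e\<close> and carries a factor 2.\<close>

lemma entropy_inequality_step_function:
  fixes \<mu> :: "complex measure" and B :: "nat \<Rightarrow> complex set" and c :: "nat \<Rightarrow> real" and K :: nat
  assumes fin: "finite_measure \<mu>" and sets: "sets \<mu> = sets circle_borel"
    and ineq: "\<And>f. continuous_on (sphere 0 1) f \<Longrightarrow> (\<And>z. norm z = 1 \<Longrightarrow> 1 \<le> f z) \<Longrightarrow>
      (\<integral>\<theta>. szego_weight \<theta> * ln (f (cis \<theta>)) \<partial>angle_measure) \<le> 2 * (\<integral>z. f z \<partial>\<mu>) + C"
    and B [measurable]: "\<And>k. B k \<in> sets borel" and c: "\<And>k. 0 \<le> c k"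
  defines "g \<equiv> \<lambda>z. 1 + (\<Sum>k<K. c k * indicat_real (B k) z)"
  shows "(\<integral>\<theta>. szego_weight \<theta> * ln (g (cis \<theta>)) \<partial>angle_measure) \<le> 2 * (\<integral>z. g z \<partial>\<mu>) + C"
proof -
  interpret mu: finite_measure \<mu> by (rule fin)
  interpret angle: prob_space angle_measure by (rule prob_space_angle_measure)
  have [measurable]: "(\<lambda>z. z) \<in> \<mu> \<rightarrow>\<^sub>M borel"
    using measurable_restrict_space1[OF measurable_ident, of borel "sphere 0 (1::real) :: complex set"]
      measurable_cong_sets[OF sets refl] unfolding circle_borel_def id_def by blast
  have int_ind: "integrable \<mu> (\<lambda>z. indicat_real S z)" if [measurable]: "S \<in> sets borel" for S
    by (rule mu.integrable_const_bound[where B = 1]) auto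
  have int_ind': "integrable angle_measure (\<lambda>\<theta>. indicat_real S (cis \<theta>))" if [measurable]: "S \<in> sets borel" for S
    by (rule angle.integrable_const_bound[where B = 1]) auto
  have szego_measurable [measurable]: "szego_weight \<in> borel_measurable borel"
    by (intro borel_measurable_continuous_onI continuous_intros)
  have g1: "1 \<le> g z" for z unfolding g_def using c by (simp add: sum_nonneg)
  have g_measurable [measurable]: "g \<in> borel_measurable borel" unfolding g_def by measurable
  have g_le: "g z \<le> 1 + (\<Sum>k<K. c k)" for z
    unfolding g_def using c by (intro add_left_mono sum_mono) (auto simp: indicator_def)
  have int_lng: "integrable angle_measure (\<lambda>\<theta>. szego_weight \<theta> * ln (g (cis \<theta>)))"
  proof (rule angle.integrable_const_bound[where B = "2 * ln (1 + (\<Sum>k<K. c k))"])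
    show "AE \<theta> in angle_measure. norm (szego_weight \<theta> * ln (g (cis \<theta>))) \<le> 2 * ln (1 + (\<Sum>k<K. c k))"
    proof (rule AE_I2)
      fix \<theta>
      have "szego_weight \<theta> * ln (g (cis \<theta>)) \<le> 2 * ln (1 + (\<Sum>k<K. c k))"
        using g1[of "cis \<theta>"] g_le[of "cis \<theta>"]
        by (intro mult_mono szego_weight_le_2 ln_mono) auto
      moreover have "0 \<le> szego_weight \<theta> * ln (g (cis \<theta>))"
        using g1[of "cis \<theta>"] by (intro mult_nonneg_nonneg szego_weight_nonneg) auto
      ultimately show "norm (szego_weight \<theta> * ln (g (cis \<theta>))) \<le> 2 * ln (1 + (\<Sum>k<K. c k))" by simp
    qed
  qed measurable
  have lin: "(\<integral>z. 1 + (\<Sum>k<K. c k * h k z) \<partial>\<mu>) = measure \<mu> (space \<mu>) + (\<Sum>k<K. c k * (\<integral>z. h k z \<partial>\<mu>))"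
    if "\<And>k. integrable \<mu> (h k)" for h :: "nat \<Rightarrow> complex \<Rightarrow> real"
    using that by (simp add: Bochner_Integration.integral_sum)
  define T where "T = (\<Sum>k<K. c k)"
  have T0: "0 \<le> T" unfolding T_def using c by (rule sum_nonneg)
  have bound: "(\<integral>\<theta>. szego_weight \<theta> * ln (g (cis \<theta>)) \<partial>angle_measure)
      \<le> 2 * (\<integral>z. g z \<partial>\<mu>) + C + 4 * T * e" if e: "0 < e" for e
  proof -
    have "\<exists>f L. continuous_on UNIV f \<and> (\<forall>z. 0 \<le> f z) \<and> (\<forall>z\<in>L. f z = 1) \<and> L \<in> sets borel \<and>
      (\<integral>z. f z \<partial>\<mu>) \<le> (\<integral>z. indicat_real (B k) z \<partial>\<mu>) + e \<and>
      (\<integral>\<theta>. indicat_real (B k - L) (cis \<theta>) \<partial>angle_measure) \<le> e" for k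
      by (rule borel_set_approx[OF fin sets B[of k] e]) blast
    then obtain f L where f: "\<And>k. continuous_on UNIV (f k)" "\<And>k z. 0 \<le> f k z" "\<And>k z. z \<in> L k \<Longrightarrow> f k z = 1"
      and L [measurable]: "\<And>k. L k \<in> sets borel"
      and f_mu: "\<And>k. (\<integral>z. f k z \<partial>\<mu>) \<le> (\<integral>z. indicat_real (B k) z \<partial>\<mu>) + e"
      and f_angle: "\<And>k. (\<integral>\<theta>. indicat_real (B k - L k) (cis \<theta>) \<partial>angle_measure) \<le> e"
      by metis
    define F where "F z = 1 + (\<Sum>k<K. c k * f k z)" for z
    define D where "D \<theta> = (\<Sum>k<K. c k * indicat_real (B k - L k) (cis \<theta>))" for \<theta>
    have F1: "1 \<le> F z" for z unfolding F_def using c f(2) by (simp add: sum_nonneg)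
    have contF: "continuous_on S F" for S
      unfolding F_def by (intro continuous_intros continuous_on_subset[OF f(1)]) auto
    have D0: "0 \<le> D \<theta>" for \<theta> unfolding D_def using c by (intro sum_nonneg) auto
    have gF: "g (cis \<theta>) - F (cis \<theta>) \<le> D \<theta>" for \<theta>
    proof -
      have "g (cis \<theta>) - F (cis \<theta>) = (\<Sum>k<K. c k * (indicat_real (B k) (cis \<theta>) - f k (cis \<theta>)))"
        unfolding g_def F_def by (simp add: sum_subtractf right_diff_distrib)
      also have "\<dots> \<le> D \<theta>"
        unfolding D_def using c f(2,3)
        by (intro sum_mono mult_left_mono) (auto simp: indicator_def)
      finally show ?thesis .
    qed
    have pw: "szego_weight \<theta> * ln (g (cis \<theta>)) \<le> szego_weight \<theta> * ln (F (cis \<theta>)) + 2 * D \<theta>" for \<theta>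
    proof -
      define x y where "x = g (cis \<theta>)" and "y = F (cis \<theta>)"
      have xy: "1 \<le> x" "1 \<le> y" "x - y \<le> D \<theta>" using g1 F1 gF by (simp_all add: x_def y_def)
      have "ln x - ln y = ln (x / y)" using xy by (simp add: ln_div)
      also have "\<dots> \<le> x / y - 1" using xy by (intro ln_le_minus_one) auto
      also have "\<dots> = (x - y) / y" using xy by (simp add: field_simps)
      also have "\<dots> \<le> D \<theta> / y" using xy by (intro divide_right_mono) auto
      also have "\<dots> \<le> D \<theta> / 1" using xy D0 by (intro divide_left_mono) auto
      finally have "szego_weight \<theta> * (ln x - ln y) \<le> szego_weight \<theta> * D \<theta>"
        by (intro mult_left_mono szego_weight_nonneg) simp
      also have "\<dots> \<le> 2 * D \<theta>" by (intro mult_right_mono szego_weight_le_2 D0)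
      finally show ?thesis unfolding x_def y_def by (simp add: right_diff_distrib)
    qed
    have int_F: "integrable angle_measure (\<lambda>\<theta>. szego_weight \<theta> * ln (F (cis \<theta>)))"
      using F1 by (intro integrable_angle_measure continuous_intros continuous_on_circle_cis[OF contF])
        (metis not_one_le_zero)
    have int_D: "integrable angle_measure D"
      unfolding D_def by (intro Bochner_Integration.integrable_sum integrable_mult_right int_ind') measurable
    have "(\<integral>\<theta>. D \<theta> \<partial>angle_measure) = (\<Sum>k<K. c k * (\<integral>\<theta>. indicat_real (B k - L k) (cis \<theta>) \<partial>angle_measure))"
      unfolding D_def by (subst Bochner_Integration.integral_sum) (auto intro!: integrable_mult_right int_ind')
    also have "\<dots> \<le> (\<Sum>k<K. c k * e)"
      using c f_angle by (intro sum_mono mult_left_mono)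
    finally have D_le: "(\<integral>\<theta>. D \<theta> \<partial>angle_measure) \<le> T * e" by (simp add: T_def sum_distrib_right)
    have "(\<integral>\<theta>. szego_weight \<theta> * ln (g (cis \<theta>)) \<partial>angle_measure)
        \<le> (\<integral>\<theta>. szego_weight \<theta> * ln (F (cis \<theta>)) + 2 * D \<theta> \<partial>angle_measure)"
      by (rule integral_mono[OF int_lng Bochner_Integration.integrable_add[OF int_F integrable_mult_right[OF int_D]] pw])
    also have "\<dots> = (\<integral>\<theta>. szego_weight \<theta> * ln (F (cis \<theta>)) \<partial>angle_measure) + 2 * (\<integral>\<theta>. D \<theta> \<partial>angle_measure)"
      using int_F int_D by simp
    also have "(\<integral>\<theta>. szego_weight \<theta> * ln (F (cis \<theta>)) \<partial>angle_measure) \<le> 2 * (\<integral>z. F z \<partial>\<mu>) + C"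
      by (rule ineq[OF contF F1])
    finally have 1: "(\<integral>\<theta>. szego_weight \<theta> * ln (g (cis \<theta>)) \<partial>angle_measure)
        \<le> 2 * (\<integral>z. F z \<partial>\<mu>) + C + 2 * (T * e)" using D_le by simp
    have int_f: "integrable \<mu> (f k)" for k
      by (rule integrable_circle[OF fin sets continuous_on_subset[OF f(1) subset_UNIV]])
    have "(\<integral>z. F z \<partial>\<mu>) = measure \<mu> (space \<mu>) + (\<Sum>k<K. c k * (\<integral>z. f k z \<partial>\<mu>))"
      unfolding F_def by (rule lin[OF int_f])
    also have "\<dots> \<le> measure \<mu> (space \<mu>) + (\<Sum>k<K. c k * ((\<integral>z. indicat_real (B k) z \<partial>\<mu>) + e))"
      using c f_mu by (intro add_left_mono sum_mono mult_left_mono)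
    also have "\<dots> = measure \<mu> (space \<mu>) + (\<Sum>k<K. c k * (\<integral>z. indicat_real (B k) z \<partial>\<mu>)) + T * e"
      by (simp add: distrib_left sum.distrib T_def sum_distrib_right)
    also have "measure \<mu> (space \<mu>) + (\<Sum>k<K. c k * (\<integral>z. indicat_real (B k) z \<partial>\<mu>)) = (\<integral>z. g z \<partial>\<mu>)"
      unfolding g_def by (rule lin[OF int_ind[OF B], symmetric])
    finally show ?thesis using 1 by simp
  qed
  show ?thesis
  proof (rule field_le_epsilon)
    fix \<delta> :: real assume \<delta>: "0 < \<delta>"
    \<comment> \<open>The denominator is increased by 1 because \<open>T\<close> may be
      zero.\<close>
    have "4 * T * (\<delta> / (4 * T + 1)) \<le> \<delta>"
      using T0 \<delta> by (simp add: field_simps)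
    then show "(\<integral>\<theta>. szego_weight \<theta> * ln (g (cis \<theta>)) \<partial>angle_measure) \<le> 2 * (\<integral>z. g z \<partial>\<mu>) + C + \<delta>"
      using bound[of "\<delta> / (4 * T + 1)"] T0 \<delta> by simp
  qed
qed

section \<open>The absolutely continuous part\<close>

text \<open>A measurable inverse of \<open>cis\<close> with values in [0, 2 pi) on the circle; it
  turns level sets of \<open>w\<close> in the angle into Borel sets of the circle.\<close>

definition circle_angle :: "complex \<Rightarrow> real" where
  "circle_angle z = (if 0 \<le> Im (Ln z) then Im (Ln z) else Im (Ln z) + 2 * pi)"

lemma circle_angle_measurable [measurable]: "circle_angle \<in> borel_measurable borel"
  unfolding circle_angle_def by measurable

lemma circle_angle_cis:
  assumes "0 \<le> \<theta>" "\<theta> < 2 * pi"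
  shows "circle_angle (cis \<theta>) = \<theta>"
proof (cases "\<theta> \<le> pi")
  case True
  have "Ln (cis \<theta>) = \<i> * \<theta>"
    unfolding cis_conv_exp using assms True by (intro Ln_exp) auto
  then show ?thesis using assms by (simp add: circle_angle_def)
next
  case False
  have "cis \<theta> = cis (\<theta> - 2 * pi)" by (simp add: complex_eq_iff cos_diff sin_diff)
  moreover have "Ln (cis (\<theta> - 2 * pi)) = \<i> * complex_of_real (\<theta> - 2 * pi)"
    unfolding cis_conv_exp using assms False by (intro Ln_exp) auto
  ultimately show ?thesis using assms by (simp add: circle_angle_def)
qed

text \<open>A step function of \<open>x\<close> that increases, up to a bounded factor, to \<open>1 / x\<close> on \<open>(0, 1)\<close> and to \<open>\<infinity>\<close> at \<open>0\<close>.\<close>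

definition dyadic_inverse :: "nat \<Rightarrow> real \<Rightarrow> real" where
  "dyadic_inverse K x = 1 + (\<Sum>k<K. 2 ^ k * (if 2 ^ k * x < 1 then 1 else 0))"

lemma dyadic_inverse_small:
  assumes "0 \<le> x" "2 ^ K * x < 1"
  shows "dyadic_inverse K x = 2 ^ K" "dyadic_inverse (Suc K) x = 2 ^ Suc K"
proof -
  have *: "dyadic_inverse m x = 2 ^ m" if "m \<le> Suc K" for m
    using that
  proof (induction m)
    case (Suc m)
    have "(2 :: real) ^ m * x \<le> 2 ^ K * x"
      using Suc.prems assms(1) by (intro mult_right_mono power_increasing) auto
    then have "2 ^ m * x < 1" using assms(2) by linarith
    then show ?case using Suc by (simp add: dyadic_inverse_def)
  qed (simp add: dyadic_inverse_def)
  then show "dyadic_inverse K x = 2 ^ K" "dyadic_inverse (Suc K) x = 2 ^ Suc K" by auto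
qed

text \<open>At the last scale \<open>K\<close> with \<open>2 ^ K * x < 1\<close> the sum reaches
  \<open>2 ^ Suc K\<close>, which is at least \<open>1 / x\<close>; later terms are zero.\<close>

lemma dyadic_inverse_mult_ge_1:
  assumes "0 \<le> x" "1 \<le> 2 ^ K * x"
  shows "1 \<le> dyadic_inverse K x * x"
  using assms(2)
proof (induction K)
  case (Suc K)
  show ?case
  proof (cases "2 ^ K * x < 1")
    case True
    then show ?thesis using dyadic_inverse_small(2)[OF assms(1) True] Suc.prems by simp
  next
    case False
    then have "dyadic_inverse (Suc K) x = dyadic_inverse K x" by (simp add: dyadic_inverse_def)
    then show ?thesis using False Suc.IH by simp
  qed
qed (simp add: dyadic_inverse_def)

text \<open>At the last active scale the sum is \<open>2 ^ Suc K - 1\<close>. The leading 1 of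
  \<open>dyadic_inverse\<close> is left out because it would add \<open>x\<close>, which is
  unbounded.\<close>

lemma dyadic_sum_le_2:
  fixes x :: real
  assumes "0 \<le> x"
  shows "(\<Sum>k<K. 2 ^ k * (if 2 ^ k * x < 1 then 1 else 0)) * x \<le> 2"
proof (induction K)
  case (Suc K)
  show ?case
  proof (cases "2 ^ K * x < 1")
    case True
    have "(\<Sum>k<Suc K. (2 :: real) ^ k * (if 2 ^ k * x < 1 then 1 else 0)) = 2 ^ Suc K - 1"
      using dyadic_inverse_small(2)[OF assms True] unfolding dyadic_inverse_def by linarith
    then have "(\<Sum>k<Suc K. 2 ^ k * (if 2 ^ k * x < 1 then 1 else 0)) * x = (2 ^ Suc K - 1) * x"
      by (rule arg_cong)
    also have "\<dots> = 2 * (2 ^ K * x) - x" by (simp add: algebra_simps)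
    finally have "(\<Sum>k<Suc K. 2 ^ k * (if 2 ^ k * x < 1 then 1 else 0)) * x = 2 * (2 ^ K * x) - x" .
    then show ?thesis using True assms by linarith
  qed (use Suc.IH in simp)
qed simp

lemma minus_ext_ln_le_SUP:
  assumes x: "0 \<le> x" and q: "0 \<le> q"
  shows "e2ennreal (- (ereal q * ext_ln x)) \<le> (SUP K. ennreal (q * ln (dyadic_inverse K x)))"
proof (cases "x = 0")
  case False
  then have x0: "0 < x" using x by simp
  obtain K where "1 / x < 2 ^ K" using real_arch_pow[of 2 "1 / x"] by auto
  then have "1 \<le> 2 ^ K * x" using x0 by (simp add: field_simps)
  then have "1 \<le> dyadic_inverse K x * x" by (rule dyadic_inverse_mult_ge_1[OF x])
  then have "1 / x \<le> dyadic_inverse K x" using x0 by (simp add: field_simps)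
  then have "ln (1 / x) \<le> ln (dyadic_inverse K x)" using x0 by (intro ln_mono) auto
  then have "- ln x \<le> ln (dyadic_inverse K x)" using x0 by (simp add: ln_div)
  then have "q * - ln x \<le> q * ln (dyadic_inverse K x)" using q by (rule mult_left_mono)
  then have "e2ennreal (- (ereal q * ext_ln x)) \<le> ennreal (q * ln (dyadic_inverse K x))"
    using x0 by (simp add: ext_ln_def ennreal_leI)
  also have "\<dots> \<le> (SUP K. ennreal (q * ln (dyadic_inverse K x)))" by (rule SUP_upper) simp
  finally show ?thesis .
next
  case True
  show ?thesis
  \<comment> \<open>Where both vanish, the convention that zero times minus infinity is zero
    applies; for positive \<open>q\<close> the supremum is infinite, as
    \<open>dyadic_inverse K 0 = 2 ^ K\<close>.\<close>
  proof (cases "q = 0")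
    case True
    then show ?thesis by (simp add: zero_ereal_def[symmetric])
  next
    case False
    have "(SUP K. ennreal (q * ln (dyadic_inverse K x))) = top"
    proof (rule ennreal_SUP_eq_top)
      fix n :: nat
      obtain K where K: "real n / (q * ln 2) < of_nat K" using reals_Archimedean2 by blast
      have "dyadic_inverse K x = 2 ^ K" using True by (intro dyadic_inverse_small) auto
      then have eq: "q * ln (dyadic_inverse K x) = real K * (q * ln 2)" by (simp add: ln_realpow)
      have "real n \<le> real K * (q * ln 2)"
        using K q False by (simp add: field_simps)
      then have "ennreal (real n) \<le> ennreal (q * ln (dyadic_inverse K x))"
        unfolding eq by (rule ennreal_leI)
      then show "\<exists>K\<in>UNIV. of_nat n \<le> ennreal (q * ln (dyadic_inverse K x))"
        by (auto simp: ennreal_of_nat_eq_real_of_nat)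
    qed
    then show ?thesis by (simp only: top_greatest)
  qed
qed

lemma ext_ln_le:
  assumes "0 \<le> x" "0 \<le> q" "q \<le> 2"
  shows "e2ennreal (ereal q * ext_ln x) \<le> 2 * ennreal x"
proof (cases "x = 0")
  case True
  then have "ereal q * ext_ln x \<le> 0"
    using assms(2) by (auto simp: ext_ln_def zero_ereal_def[symmetric] ereal_mult_le_0_iff)
  then show ?thesis by (simp add: e2ennreal_neg)
next
  case False
  then have x: "0 < x" using assms(1) by simp
  have "q * ln x \<le> q * x" using ln_le_minus_one[OF x] assms(2) by (intro mult_left_mono) auto
  also have "\<dots> \<le> 2 * x" using assms(3) x by (intro mult_right_mono) auto
  finally have "ennreal (q * ln x) \<le> ennreal (2 * x)" by (rule ennreal_leI)
  then show ?thesis using x by (simp add: ext_ln_def ennreal_mult)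
qed

lemma cis_measurable_circle [measurable]: "cis \<in> borel \<rightarrow>\<^sub>M circle_borel"
  unfolding circle_borel_def by (rule measurable_restrict_space2) auto

lemma cis_measurable_angle: "cis \<in> angle_measure \<rightarrow>\<^sub>M circle_borel"
  using measurable_cong_sets[OF sets_angle_measure refl] cis_measurable_circle by blast

lemma sets_circle_borel_iff: "A \<in> sets circle_borel \<longleftrightarrow> A \<subseteq> sphere 0 1 \<and> A \<in> sets borel"
  unfolding circle_borel_def by (rule sets_restrict_space_iff) simp

lemma emeasure_ac_part:
  assumes [measurable]: "w \<in> borel_measurable borel" and A: "A \<in> sets circle_borel"
  shows "emeasure (ac_part w) A = (\<integral>\<^sup>+\<theta>. ennreal (w \<theta>) * indicator A (cis \<theta>) \<partial>angle_measure)"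
proof -
  have [measurable]: "A \<in> sets borel" using A by (simp add: sets_circle_borel_iff)
  have "emeasure (ac_part w) A
      = emeasure (density angle_measure (\<lambda>\<theta>. ennreal (w \<theta>))) (cis -` A \<inter> space angle_measure)"
    unfolding ac_part_def by (subst emeasure_distr) (use A in auto)
  also have "\<dots> = (\<integral>\<^sup>+\<theta>. ennreal (w \<theta>) * indicator (cis -` A \<inter> space angle_measure) \<theta> \<partial>angle_measure)"
  proof (rule emeasure_density)
    show "cis -` A \<inter> space angle_measure \<in> sets angle_measure"
      by (rule measurable_sets[of cis angle_measure borel]) (auto intro: cis_measurable)
  qed simp
  also have "\<dots> = (\<integral>\<^sup>+\<theta>. ennreal (w \<theta>) * indicator A (cis \<theta>) \<partial>angle_measure)"
    by (intro nn_integral_cong) (simp add: indicator_def)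
  finally show ?thesis .
qed

text \<open>The negative part is controlled by testing the inequality with step functions
  \<open>g K\<close> that increase to a function comparable to 1 / w. The positive part needs only
  ln w \<le> w and the finite mass of \<mu>.\<close>

lemma szego_integral_finite:
  fixes \<mu> \<mu>\<^sub>s :: "complex measure"
  assumes "prob_space \<mu>" and sets: "sets \<mu> = sets circle_borel"
    and decomp: "lebesgue_decomposition \<mu> w \<mu>\<^sub>s"
    and ineq: "\<And>f. continuous_on (sphere 0 1) f \<Longrightarrow> (\<And>z. norm z = 1 \<Longrightarrow> 1 \<le> f z) \<Longrightarrow>
      (\<integral>\<theta>. szego_weight \<theta> * ln (f (cis \<theta>)) \<partial>angle_measure) \<le> 2 * (\<integral>z. f z \<partial>\<mu>) + C"
  shows "\<bar>ereal_integral angle_measure (\<lambda>\<theta>. ereal (szego_weight \<theta>) * ext_ln (w \<theta>))\<bar> \<noteq> \<infinity>"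
proof -
  interpret mu: prob_space \<mu> by fact
  interpret angle: prob_space angle_measure by (rule prob_space_angle_measure)
  have w [measurable]: "w \<in> borel_measurable borel" and w0: "\<And>\<theta>. \<theta> \<in> {0..<2 * pi} \<Longrightarrow> 0 \<le> w \<theta>"
    and sing: "mutually_singular \<mu>\<^sub>s arc_measure"
    and mu_eq: "\<And>A. A \<in> sets circle_borel \<Longrightarrow> emeasure \<mu> A = emeasure (ac_part w) A + emeasure \<mu>\<^sub>s A"
    using decomp unfolding lebesgue_decomposition_def by auto
  have sets_arc: "sets arc_measure = sets circle_borel" by (simp add: arc_measure_def)
  obtain A where A: "A \<in> sets circle_borel" "emeasure \<mu>\<^sub>s A = 0"
    "emeasure arc_measure (space arc_measure - A) = 0"
    using sing sets_arc unfolding mutually_singular_def by auto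
  have [measurable]: "A \<in> sets borel" using A by (simp add: sets_circle_borel_iff)
  have [measurable]: "sphere (0 :: complex) 1 \<in> sets borel" by simp
  have circle_set: "sphere 0 1 \<in> sets circle_borel" by (simp add: sets_circle_borel_iff)
  have space_arc: "space arc_measure = sphere 0 1" by (rule space_circle[OF sets_arc])
  have [measurable]: "szego_weight \<in> borel_measurable borel"
    by (intro borel_measurable_continuous_onI continuous_intros)
  have AE_A: "AE \<theta> in angle_measure. cis \<theta> \<in> A"
  proof -
    have "space arc_measure - A \<in> null_sets arc_measure"
      using A circle_set unfolding space_arc by (intro null_setsI) (auto simp: sets_arc space_arc[symmetric])
    then have "AE z in arc_measure. z \<notin> space arc_measure - A" by (rule AE_not_in)
    then have "AE z in arc_measure. z \<in> A" by (rule AE_mp) (auto intro: AE_I2)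
    then show ?thesis unfolding arc_measure_def by (rule AE_distrD[OF cis_measurable_angle])
  qed
  have AE_range: "AE \<theta> in angle_measure. \<theta> \<in> {0..<2 * pi}" by (rule AE_angle_measure)
  \<comment> \<open>Restricting to \<open>A\<close>, which is null for the singular part and has
    full arc measure, makes \<mu> of these sets an integral of \<open>w\<close> alone.\<close>
  define B where "B k = {z \<in> A. 2 ^ k * w (circle_angle z) < 1}" for k :: nat
  have B_borel [measurable]: "B k \<in> sets borel" for k unfolding B_def by measurable
  have B_circle: "B k \<in> sets circle_borel" for k
    using A(1) B_borel[of k] unfolding sets_circle_borel_iff B_def by auto
  have ind_B: "indicat_real (B k) (cis \<theta>) = (if 2 ^ k * w \<theta> < 1 then 1 else 0)"
    if "\<theta> \<in> {0..<2 * pi}" "cis \<theta> \<in> A" for k \<theta>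
    using that circle_angle_cis[of \<theta>] by (simp add: B_def indicator_def)
  define g where "g K z = 1 + (\<Sum>k<K. 2 ^ k * indicat_real (B k) z)" for K z
  have g_cis: "g K (cis \<theta>) = dyadic_inverse K (w \<theta>)" if "\<theta> \<in> {0..<2 * pi}" "cis \<theta> \<in> A" for K \<theta>
    unfolding g_def dyadic_inverse_def using ind_B[OF that] by simp
  have emeasure_B: "emeasure \<mu> (B k) = (\<integral>\<^sup>+\<theta>. ennreal (w \<theta>) * indicator (B k) (cis \<theta>) \<partial>angle_measure)" for k
  proof -
    have "emeasure \<mu>\<^sub>s (B k) \<le> emeasure \<mu>\<^sub>s A"
      using A(1) sing sets_arc by (intro emeasure_mono) (auto simp: B_def mutually_singular_def)
    then show ?thesis using A(2) mu_eq[OF B_circle] emeasure_ac_part[OF w B_circle] by simp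
  qed
  \<comment> \<open>1 is the total mass and 2 the bound on the dyadic sum times \<open>w\<close>;
    the estimate is uniform in \<open>K\<close>.\<close>
  have g_mu: "(\<integral>z. g K z \<partial>\<mu>) \<le> 3" for K
  proof -
    have "ennreal (\<Sum>k<K. 2 ^ k * measure \<mu> (B k)) = (\<Sum>k<K. ennreal (2 ^ k) * emeasure \<mu> (B k))"
      by (simp add: sum_ennreal[symmetric] ennreal_mult mu.emeasure_eq_measure)
    also have "\<dots> = (\<integral>\<^sup>+\<theta>. (\<Sum>k<K. ennreal (2 ^ k) * (ennreal (w \<theta>) * indicator (B k) (cis \<theta>))) \<partial>angle_measure)"
      unfolding emeasure_B by (subst nn_integral_sum) (auto simp: nn_integral_cmult)
    also have "\<dots> \<le> (\<integral>\<^sup>+\<theta>. 2 \<partial>angle_measure)"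
    proof (rule nn_integral_mono_AE)
      show "AE \<theta> in angle_measure. (\<Sum>k<K. ennreal (2 ^ k) * (ennreal (w \<theta>) * indicator (B k) (cis \<theta>))) \<le> 2"
        using AE_range AE_A
      proof eventually_elim
        fix \<theta> assume \<theta>: "\<theta> \<in> {0..<2 * pi}" "cis \<theta> \<in> A"
        have "ennreal (2 ^ k) * (ennreal (w \<theta>) * indicator (B k) (cis \<theta>))
            = ennreal (2 ^ k * (if 2 ^ k * w \<theta> < 1 then 1 else 0) * w \<theta>)" for k
          using ind_B[OF \<theta>, of k] w0[OF \<theta>(1)] by (auto simp: indicator_def ennreal_mult split: if_splits)
        then have "(\<Sum>k<K. ennreal (2 ^ k) * (ennreal (w \<theta>) * indicator (B k) (cis \<theta>)))
            = ennreal ((\<Sum>k<K. 2 ^ k * (if 2 ^ k * w \<theta> < 1 then 1 else 0)) * w \<theta>)"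
          using w0[OF \<theta>(1)] by (simp only: sum_distrib_right) (rule sum_ennreal, simp)
        also have "\<dots> \<le> ennreal 2" by (intro ennreal_leI dyadic_sum_le_2 w0[OF \<theta>(1)])
        finally show "(\<Sum>k<K. ennreal (2 ^ k) * (ennreal (w \<theta>) * indicator (B k) (cis \<theta>))) \<le> 2" by simp
      qed
    qed
    also have "\<dots> = ennreal 2" using angle.emeasure_space_1 by simp
    finally have "(\<Sum>k<K. 2 ^ k * measure \<mu> (B k)) \<le> 2"
      by (simp only: ennreal_le_iff zero_le_numeral)
    moreover have "(\<integral>z. g K z \<partial>\<mu>) = 1 + (\<Sum>k<K. 2 ^ k * measure \<mu> (B k))"
    proof -
      have "B k \<in> sets \<mu>" for k using B_circle sets by simp
      then have i: "integrable \<mu> (\<lambda>z. 2 ^ k * indicat_real (B k) z)" for k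
        by (intro integrable_mult_right integrable_real_indicator) (auto simp: mu.emeasure_eq_measure)
      have "(\<integral>z. g K z \<partial>\<mu>) = 1 + (\<Sum>k<K. (\<integral>z. 2 ^ k * indicat_real (B k) z \<partial>\<mu>))"
        unfolding g_def using i
        by (subst Bochner_Integration.integral_add)
           (auto intro!: Bochner_Integration.integrable_sum simp: Bochner_Integration.integral_sum mu.prob_space
             simp del: sum_mult_indicator)
      moreover have "(\<integral>z. 2 ^ k * indicat_real (B k) z \<partial>\<mu>) = 2 ^ k * measure \<mu> (B k)" for k
        using B_circle sets by (simp add: mu.measure_space_inter)
      ultimately show ?thesis by simp
    qed
    ultimately show ?thesis by simp
  qed
  have int_bound: "(\<integral>\<theta>. szego_weight \<theta> * ln (g K (cis \<theta>)) \<partial>angle_measure) \<le> 6 + C" for K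
  proof -
    have "(\<integral>\<theta>. szego_weight \<theta> * ln (g K (cis \<theta>)) \<partial>angle_measure) \<le> 2 * (\<integral>z. g K z \<partial>\<mu>) + C"
      unfolding g_def
      by (rule entropy_inequality_step_function[OF mu.finite_measure_axioms sets ineq B_borel]) auto
    then show ?thesis using g_mu[of K] by simp
  qed
  have g1: "1 \<le> g K z" for K z unfolding g_def by (simp add: sum_nonneg)
  have g_le: "g K z \<le> 1 + (\<Sum>k<K. 2 ^ k)" for K z
    unfolding g_def by (intro add_left_mono sum_mono) (auto simp: indicator_def)
  have g_mono: "g K z \<le> g (Suc K) z" for K z by (simp add: g_def)
  have g_meas [measurable]: "g K \<in> borel_measurable borel" for K unfolding g_def by measurable
  have term0: "0 \<le> szego_weight \<theta> * ln (g K (cis \<theta>))" for K \<theta>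
    using g1[of K "cis \<theta>"] by (intro mult_nonneg_nonneg szego_weight_nonneg) auto
  have nn: "(\<integral>\<^sup>+\<theta>. ennreal (szego_weight \<theta> * ln (g K (cis \<theta>))) \<partial>angle_measure) \<le> ennreal (6 + C)" for K
  proof -
    have "integrable angle_measure (\<lambda>\<theta>. szego_weight \<theta> * ln (g K (cis \<theta>)))"
    proof (rule angle.integrable_const_bound[where B = "2 * ln (1 + (\<Sum>k<K. 2 ^ k))"])
      have "szego_weight \<theta> * ln (g K (cis \<theta>)) \<le> 2 * ln (1 + (\<Sum>k<K. 2 ^ k))" for \<theta>
        using g1[of K "cis \<theta>"] g_le[of K "cis \<theta>"]
        by (intro mult_mono szego_weight_le_2 ln_mono) auto
      then show "AE \<theta> in angle_measure. norm (szego_weight \<theta> * ln (g K (cis \<theta>))) \<le> 2 * ln (1 + (\<Sum>k<K. 2 ^ k))"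
        using term0 by (intro AE_I2) simp
    qed measurable
    then have "(\<integral>\<^sup>+\<theta>. ennreal (szego_weight \<theta> * ln (g K (cis \<theta>))) \<partial>angle_measure)
        = ennreal (\<integral>\<theta>. szego_weight \<theta> * ln (g K (cis \<theta>)) \<partial>angle_measure)"
      by (intro nn_integral_eq_integral AE_I2 term0)
    then show ?thesis using int_bound[of K] by (simp add: ennreal_leI)
  qed
  have neg: "(\<integral>\<^sup>+\<theta>. e2ennreal (- (ereal (szego_weight \<theta>) * ext_ln (w \<theta>))) \<partial>angle_measure) \<le> ennreal (6 + C)"
  proof -
    have "(\<integral>\<^sup>+\<theta>. e2ennreal (- (ereal (szego_weight \<theta>) * ext_ln (w \<theta>))) \<partial>angle_measure)
        \<le> (\<integral>\<^sup>+\<theta>. (SUP K. ennreal (szego_weight \<theta> * ln (g K (cis \<theta>)))) \<partial>angle_measure)"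
    proof (rule nn_integral_mono_AE)
      show "AE \<theta> in angle_measure. e2ennreal (- (ereal (szego_weight \<theta>) * ext_ln (w \<theta>)))
          \<le> (SUP K. ennreal (szego_weight \<theta> * ln (g K (cis \<theta>))))"
        using AE_range AE_A
      proof eventually_elim
        fix \<theta> assume \<theta>: "\<theta> \<in> {0..<2 * pi}" "cis \<theta> \<in> A"
        show "e2ennreal (- (ereal (szego_weight \<theta>) * ext_ln (w \<theta>)))
          \<le> (SUP K. ennreal (szego_weight \<theta> * ln (g K (cis \<theta>))))"
          unfolding g_cis[OF \<theta>] by (rule minus_ext_ln_le_SUP[OF w0[OF \<theta>(1)] szego_weight_nonneg])
      qed
    qed
    \<comment> \<open>Monotone convergence keeps the bound, and also forces it at angles where
      \<open>w\<close> is zero.\<close>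
    also have "\<dots> = (SUP K. (\<integral>\<^sup>+\<theta>. ennreal (szego_weight \<theta> * ln (g K (cis \<theta>))) \<partial>angle_measure))"
    proof (rule nn_integral_monotone_convergence_SUP)
      show "incseq (\<lambda>K \<theta>. ennreal (szego_weight \<theta> * ln (g K (cis \<theta>))))"
      proof (rule incseq_SucI, rule le_funI)
        fix K \<theta>
        have "ln (g K (cis \<theta>)) \<le> ln (g (Suc K) (cis \<theta>))"
          using g1[of K "cis \<theta>"] g_mono[of K "cis \<theta>"] by (intro ln_mono) auto
        then show "ennreal (szego_weight \<theta> * ln (g K (cis \<theta>))) \<le> ennreal (szego_weight \<theta> * ln (g (Suc K) (cis \<theta>)))"
          by (intro ennreal_leI mult_left_mono szego_weight_nonneg)
      qed
    qed measurable
    also have "\<dots> \<le> ennreal (6 + C)" by (intro SUP_least nn)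
    finally show ?thesis .
  qed
  have pos: "(\<integral>\<^sup>+\<theta>. e2ennreal (ereal (szego_weight \<theta>) * ext_ln (w \<theta>)) \<partial>angle_measure) \<le> 2"
  proof -
    have "(\<integral>\<^sup>+\<theta>. e2ennreal (ereal (szego_weight \<theta>) * ext_ln (w \<theta>)) \<partial>angle_measure)
        \<le> (\<integral>\<^sup>+\<theta>. 2 * (ennreal (w \<theta>) * indicator (sphere 0 1) (cis \<theta>)) \<partial>angle_measure)"
    proof (rule nn_integral_mono_AE)
      show "AE \<theta> in angle_measure. e2ennreal (ereal (szego_weight \<theta>) * ext_ln (w \<theta>))
          \<le> 2 * (ennreal (w \<theta>) * indicator (sphere 0 1) (cis \<theta>))"
        using AE_range
      proof eventually_elim
        fix \<theta> :: real assume "\<theta> \<in> {0..<2 * pi}"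
        from ext_ln_le[OF w0[OF this] szego_weight_nonneg szego_weight_le_2]
        show "e2ennreal (ereal (szego_weight \<theta>) * ext_ln (w \<theta>))
          \<le> 2 * (ennreal (w \<theta>) * indicator (sphere 0 1) (cis \<theta>))" by simp
      qed
    qed
    also have "\<dots> = 2 * emeasure (ac_part w) (sphere 0 1)"
      unfolding emeasure_ac_part[OF w circle_set] by (rule nn_integral_cmult) measurable
    also have "\<dots> \<le> 2 * emeasure \<mu> (sphere 0 1)"
      unfolding mu_eq[OF circle_set] by (intro mult_left_mono) auto
    also have "\<dots> \<le> 2 * 1" by (intro mult_left_mono mu.emeasure_le_1) auto
    finally show ?thesis by simp
  qed
  show ?thesis
    unfolding ereal_integral_finite_iff
    using neg pos by (auto intro: le_less_trans)
qed

theorem theorem9p1: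
  fixes \<mu> \<mu>\<^sub>s :: "complex measure" and w :: "real \<Rightarrow> real" and \<alpha> :: "nat \<Rightarrow> complex"
  assumes "prob_space \<mu>" and "sets \<mu> = sets circle_borel"
    and "infinite (measure_support \<mu>)"
    and "lebesgue_decomposition \<mu> w \<mu>\<^sub>s"
    and "verblunsky_coefficients \<mu> \<alpha>"
    and "\<forall>n. \<alpha> n \<in> \<real>"
    and "in_ell 2 ((shift_minus_1 ^^ 2) (shift_plus_1 \<alpha>))"
    and "in_ell 4 ((shift_minus_1 ^^ 2) \<alpha>)"
    and "in_ell 6 \<alpha>"
  shows "\<bar>ereal_integral angle_measure
           (\<lambda>\<theta>. ereal ((1 - cos \<theta>)\<^sup>2 * (1 + cos \<theta>)) * ext_ln (w \<theta>))\<bar> \<noteq> \<infinity>"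
proof -
  obtain \<Phi> where \<Phi>: "monic_orthogonal_polys \<mu> \<Phi>"
    "\<And>n. \<Phi> (Suc n) = [:0, 1:] * \<Phi> n - smult (cnj (\<alpha> n)) (reversed_poly (\<Phi> n))"
    using assms(5) unfolding verblunsky_coefficients_def by blast
  have deg: "degree (\<Phi> n) = n" and lead: "lead_coeff (\<Phi> n) = 1"
    and orth: "m \<noteq> n \<Longrightarrow> (\<integral>z. cnj (poly (\<Phi> m) z) * poly (\<Phi> n) z \<partial>\<mu>) = 0" for m n
    using \<Phi>(1) unfolding monic_orthogonal_polys_def by blast+
  interpret prob_space \<mu> by (rule assms(1))
  interpret circle_opuc \<Phi> \<alpha> \<mu>
    by (unfold_locales; fact deg lead orth \<Phi>(2) assms(2,3))
  define a where "a n = Re (\<alpha> n)" for n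
  have real: "\<alpha> n = complex_of_real (a n)" for n
    using assms(6) unfolding a_def by (metis Reals_cases Re_complex_of_real)
  \<comment> \<open>(S - 1)^2 (S + 1) = S^3 - S^2 - S + 1. For even exponents the norms may then be
    dropped.\<close>
  have "(shift_minus_1 ^^ 2) (shift_plus_1 \<alpha>) n = complex_of_real (a (n + 3) - a (n + 2) - a (n + 1) + a n)" for n
    by (simp add: numeral_2_eq_2 numeral_3_eq_3 shift_minus_1_def shift_plus_1_def shift_def real)
  then have s2: "summable (\<lambda>n. (a (n + 3) - a (n + 2) - a (n + 1) + a n)\<^sup>2)"
    using assms(7) unfolding in_ell_def by (simp add: powr_numeral del: of_real_add of_real_diff)
  have "(shift_minus_1 ^^ 2) \<alpha> n = complex_of_real (a (n + 2) - 2 * a (n + 1) + a n)" for n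
    by (simp add: numeral_2_eq_2 shift_minus_1_def shift_def real)
  then have s4: "summable (\<lambda>n. (a (n + 2) - 2 * a (n + 1) + a n) ^ 4)"
    using assms(8) unfolding in_ell_def by (simp add: powr_numeral power_even_abs del: of_real_add of_real_diff)
  have s6: "summable (\<lambda>n. a n ^ 6)"
    using assms(9) unfolding in_ell_def real by (simp add: powr_numeral power_even_abs)
  obtain C where "\<And>N. - (\<integral>\<theta>. szego_weight \<theta> * ln (bs_weight (N + 3) \<theta>) \<partial>angle_measure) \<le> C"
    using entropy_bounded_below[OF real s2 s4 s6] by blast
  note ineq = entropy_inequality_continuous[OF this]
  show ?thesis
    using szego_integral_finite[OF assms(1,2,4) ineq] unfolding szego_weight_def .
qed

end
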